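(* Let $k,r,t$ be positive integers with $k>r$, and let $\gamma>0$. There exist $\varepsilon>0$ and $n_0\in\mathbb N$ such that for every integer $n\ge n_0$ the following holds. If $G\in\mathcal G_k(n)$ contains no copy of $K_{r+1}(t)$ and $e(G)\ge (t_r(k)-\varepsilon)n^2$, then $G$ is $\gamma$-close to some member of $\mathcal T_{r,k}(n)$. In particular, $e(G)\le (t_r(k)+\gamma)n^2$.
   Context: $K_{r+1}(t)$ is the complete $(r+1)$-partite graph with $t$ vertices in each part. $\mathcal G_k(n)$ is the family of $k$-partite graphs on fixed vertex classes $V_1,\dots,V_k$, each of size $n$ (edges only between different classes). $t_r(k)$ is the number of edges of the Turán graph $T_r(k)$ (complete $r$-partite graph on $k$ vertices with parts as equal as possible). Two graphs $G,H\in\mathcal G_k(n)$ on the same classes are $\gamma$-close if $|E(G)\triangle E(H)|\le\gamma n^2$. Write $k=ar+b$ with $0\le b<r$. $\mathcal T_{r,k}(n)$ is the set of graphs $T$ on classes $V_1,\dots,V_k$ obtained as follows: if $b>0$, partition $V_{ar+1}\cup\cdots\cup V_k$ arbitrarily into $r$ sets $W_1,\dots,W_r$ (some possibly empty) such that each $W_i$ is a subset of a single class $V_j$; if $b=0$, let $W_1=\dots=W_r=\emptyset$. Let $Z_i=V_{(i-1)a+1}\cup\cdots\cup V_{ia}$ and $U_i=W_i\cup Z_i$ for $i\in[r]$. Then $T=K(U_1,\dots,U_r)\cap K(V_1,\dots,V_k)$, i.e. $uv$ is an edge of $T$ iff $u,v$ lie in different sets $U_i$ and in different classes $V_j$.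
   Formalization: T_{r,k}(n) is taken over all numberings of the classes V_1,…,V_k; with the single fixed numbering the claim is false (r=2, k=4, t=1: the graph with V_1∪V_3 completely joined to V_2∪V_4, except inside classes, is extremal but far from the only member). *)

theory Defs
  imports Complex_Main "HOL-Library.Disjoint_Sets" "HOL-Combinatorics.Permutations"
begin

type_synonym 'v graph = "'v set \<times> 'v set set"

abbreviation verts :: "'v graph \<Rightarrow> 'v set" where "verts \<equiv> fst"

abbreviation edges :: "'v graph \<Rightarrow> 'v set set" where "edges \<equiv> snd"

text \<open>The graph K(U 1, ..., U m); it is only used for pairwise disjoint U 1, ..., U m, so
  every edge is a two-element set.\<close>

definition complete_multipartite :: "nat \<Rightarrow> (nat \<Rightarrow> 'v set) \<Rightarrow> 'v graph" where
  "complete_multipartite m U =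
     (\<Union>i\<in>{1..m}. U i,
      {{u, v} | u v. \<exists>i\<in>{1..m}. \<exists>j\<in>{1..m}. i \<noteq> j \<and> u \<in> U i \<and> v \<in> U j})"

definition balanced_complete_multipartite :: "nat \<Rightarrow> nat \<Rightarrow> (nat \<times> nat) graph" where
  "balanced_complete_multipartite m t = complete_multipartite m (\<lambda>i. {i} \<times> {1..t})"

text \<open>The residue classes modulo r split {1..k} into r parts that are as equal as possible.\<close>

definition turan_graph :: "nat \<Rightarrow> nat \<Rightarrow> nat graph" where
  "turan_graph r k = complete_multipartite r (\<lambda>i. {v \<in> {1..k}. v mod r = i mod r})"

definition turan_edges :: "nat \<Rightarrow> nat \<Rightarrow> nat" where
  "turan_edges r k = card (edges (turan_graph r k))"

text \<open>A copy is a not necessarily induced subgraph.\<close>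

definition contains_copy :: "'v graph \<Rightarrow> 'w graph \<Rightarrow> bool" where
  "contains_copy G H \<longleftrightarrow>
     (\<exists>f. inj_on f (verts H) \<and> f ` verts H \<subseteq> verts G \<and> (\<forall>e\<in>edges H. f ` e \<in> edges G))"

definition vertex_classes :: "nat \<Rightarrow> nat \<Rightarrow> (nat \<Rightarrow> 'v set) \<Rightarrow> bool" where
  "vertex_classes k n V \<longleftrightarrow>
     disjoint_family_on V {1..k} \<and> (\<forall>j\<in>{1..k}. finite (V j) \<and> card (V j) = n)"

definition multipartite_graphs :: "nat \<Rightarrow> (nat \<Rightarrow> 'v set) \<Rightarrow> 'v graph set" where
  "multipartite_graphs k V =
     {G. verts G = (\<Union>j\<in>{1..k}. V j) \<and> edges G \<subseteq> edges (complete_multipartite k V)}"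

definition close :: "real \<Rightarrow> nat \<Rightarrow> 'v graph \<Rightarrow> 'v graph \<Rightarrow> bool" where
  "close \<gamma> n G H \<longleftrightarrow>
     real (card ((edges G - edges H) \<union> (edges H - edges G))) \<le> \<gamma> * (real n)\<^sup>2"

text \<open>Here a = k div r and b = k mod r. If b = 0, the leftover union is empty, so the partition
  condition forces every W i to be empty.\<close>

definition labelled_turan_family :: "nat \<Rightarrow> nat \<Rightarrow> (nat \<Rightarrow> 'v set) \<Rightarrow> 'v graph set" where
  "labelled_turan_family r k V =
     (let a = k div r in
      {T. \<exists>W Z U.
         disjoint_family_on W {1..r} \<and>
         (\<Union>i\<in>{1..r}. W i) = (\<Union>j\<in>{a * r + 1..k}. V j) \<and>
         (\<forall>i\<in>{1..r}. \<exists>j\<in>{1..k}. W i \<subseteq> V j) \<and>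
         (\<forall>i\<in>{1..r}. Z i = (\<Union>j\<in>{(i - 1) * a + 1..i * a}. V j)) \<and>
         (\<forall>i\<in>{1..r}. U i = W i \<union> Z i) \<and>
         T = (\<Union>j\<in>{1..k}. V j,
              edges (complete_multipartite r U) \<inter> edges (complete_multipartite k V))})"

text \<open>The enumeration of the classes is arbitrary: the family ranges over all ways of numbering
  them. With one fixed numbering the stability statement would fail, e.g. for r = 2 and k = 4 the
  graph K(V 1 \<union> V 3, V 2 \<union> V 4) without the edges inside classes is extremal, but far from
  K(V 1 \<union> V 2, V 3 \<union> V 4).\<close>

definition turan_family :: "nat \<Rightarrow> nat \<Rightarrow> (nat \<Rightarrow> 'v set) \<Rightarrow> 'v graph set" where
  "turan_family r k V = (\<Union>\<sigma>\<in>{\<sigma>. \<sigma> permutes {1..k}}. labelled_turan_family r k (V \<circ> \<sigma>))"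

end

theory Submission imports Defs begin

text \<open>Choose one vertex from each class at random and look at the graph this transversal induces on
  the k classes. By supersaturation it almost never contains a clique on r + 1 vertices, and its
  expected number of edges is almost the Turan number; hence, by the uniqueness part of Turan's
  theorem, almost every transversal induces exactly the Turan graph. Fix a transversal v such that
  for almost all transversals w every mixture of v and w induces the Turan graph. The adjacencies
  to v then assign each vertex a label in {1..r}, and almost all pairs of vertices in different
  classes are adjacent iff their labels differ. Finally discard the labels that are rare within a
  class. Every selection of one remaining label per class occurs in some good transversal and is
  therefore balanced, which forces the structure of the family.\<close>

subsection \<open>Turan's theorem with uniqueness\<close>

text \<open>A Turan graph determines its colour classes but not their names, so colourings of
  different transversals cannot be compared directly. A reference transversal v with a fixed
  colouring provides the names, yet a vertex x is then judged only by its adjacencies to v. To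
  control the adjacency of two vertices x, y of another transversal w, the hybrids with one or two
  members of v replaced must be Turan too; this is why mixtures are required to be good. The
  obstacle is a colour class of only one or two vertices: after the replacement no member of v need
  carry the colour of x or y, and then the number of colours still missing has to decide instead of
  an adjacency.

  Two gaps make the estimates work. Edge numbers are integers, so a clique-free non-Turan
  transversal loses at least one edge, and a deficit of \<epsilon> n^2 edges leaves only a
  proportion of order \<epsilon> of such transversals. And a selection of labels, each of frequency
  at least \<eta> in its class, is realised by at least (\<eta> n)^k transversals, so a bad
  proportion \<theta> < \<eta>^k cannot hide all of them.\<close>

lemma finite_pairs:
  assumes "finite A" "finite B"
  shows "finite {(x, y). x \<in> A \<and> y \<in> B \<and> P x y}"
  by (rule finite_subset[of _ "A \<times> B"]) (use assms in auto)

text \<open>Furedi's proof of stability: put the non-neighbours of a vertex of maximum degree into the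
  last part and recurse into its neighbourhood. Edges are counted as ordered pairs.\<close>

lemma furedi_partition:
  fixes H :: "'a \<Rightarrow> 'a \<Rightarrow> bool"
  assumes "finite X" "symp H" "irreflp H"
    and "\<And>K. K \<subseteq> X \<Longrightarrow> card K = Suc r \<Longrightarrow> \<not> pairwise H K"
  shows "\<exists>c. c ` X \<subseteq> {1..r} \<and>
     card {(x, y) \<in> X \<times> X. H x y} + card {(x, y) \<in> X \<times> X. H x y \<and> c x = c y}
       \<le> card {(x, y) \<in> X \<times> X. c x \<noteq> c y}"
  using assms
proof (induction r arbitrary: X)
  case 0
  have "X = {}"
  proof (rule ccontr)
    assume "X \<noteq> {}"
    then obtain x where "x \<in> X" by blast
    then show False using "0.prems"(4)[of "{x}"] by simp
  qed
  then show ?case by simp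
next
  case (Suc r)
  show ?case
  proof (cases "X = {}")
    case False
    define deg where "deg x = card {y \<in> X. H x y}" for x
    have "Max (deg ` X) \<in> deg ` X" using Suc.prems(1) False by (intro Max_in) auto
    then obtain v where v: "v \<in> X" "deg v = Max (deg ` X)" by auto
    have vmax: "deg x \<le> deg v" if "x \<in> X" for x
      using that v(2) Suc.prems(1) by simp
    define N where "N = {y \<in> X. H v y}"
    define M where "M = X - N"
    have fin: "finite N" "finite M" and X: "X = N \<union> M" and disj: "N \<inter> M = {}"
      using Suc.prems(1) by (auto simp: N_def M_def)
    have "\<exists>c. c ` N \<subseteq> {1..r} \<and>
       card {(x, y) \<in> N \<times> N. H x y} + card {(x, y) \<in> N \<times> N. H x y \<and> c x = c y}
       \<le> card {(x, y) \<in> N \<times> N. c x \<noteq> c y}"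
    proof (rule Suc.IH[OF fin(1) Suc.prems(2,3)])
      fix K assume K: "K \<subseteq> N" "card K = Suc r"
      show "\<not> pairwise H K"
      proof
        assume "pairwise H K"
        then have "pairwise H (insert v K)"
          using K(1) sympD[OF Suc.prems(2)] by (auto simp: pairwise_insert N_def)
        moreover have "v \<notin> K" using K(1) irreflpD[OF Suc.prems(3)] by (auto simp: N_def)
        moreover have "finite K" using K(2) card.infinite by fastforce
        ultimately show False
          using Suc.prems(4)[of "insert v K"] K v(1) by (auto simp: N_def)
      qed
    qed
    then obtain c where c: "c ` N \<subseteq> {1..r}"
       "card {(x, y) \<in> N \<times> N. H x y} + card {(x, y) \<in> N \<times> N. H x y \<and> c x = c y}
       \<le> card {(x, y) \<in> N \<times> N. c x \<noteq> c y}" by blast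
    define d where "d x = (if x \<in> N then c x else Suc r)" for x
    have cr: "c x \<noteq> Suc r" if "x \<in> N" for x using c(1) that by fastforce
    have split: "card {(x, y) \<in> X \<times> X. P x y} =
        card {(x, y) \<in> N \<times> N. P x y} + card {(x, y) \<in> N \<times> M. P x y}
        + card {(x, y) \<in> M \<times> N. P x y} + card {(x, y) \<in> M \<times> M. P x y}" for P :: "'a \<Rightarrow> 'a \<Rightarrow> bool"
    proof -
      define p where "p A B = {(x, y) \<in> A \<times> B. P x y}" for A B
      have fp: "finite (p N N)" "finite (p N M)" "finite (p M N)" "finite (p M M)"
        using fin by (simp_all add: p_def finite_pairs)
      have "p X X = ((p N N \<union> p N M) \<union> p M N) \<union> p M M"
        using X by (auto simp: p_def)
      moreover have "p N N \<inter> p N M = {}" "(p N N \<union> p N M) \<inter> p M N = {}"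
        "((p N N \<union> p N M) \<union> p M N) \<inter> p M M = {}"
        using disj by (auto simp: p_def)
      ultimately have "card (p X X) = card (p N N) + card (p N M) + card (p M N) + card (p M M)"
        using fp by (simp add: card_Un_disjoint)
      then show ?thesis unfolding p_def .
    qed
    have swap: "card {(x, y) \<in> N \<times> M. P x y} = card {(x, y) \<in> M \<times> N. P x y}"
      if "\<And>x y. P x y = P y x" for P :: "'a \<Rightarrow> 'a \<Rightarrow> bool"
    proof -
      have "{(x, y) \<in> M \<times> N. P x y} = prod.swap ` {(x, y) \<in> N \<times> M. P x y}"
        using that by force
      then show ?thesis by (simp add: card_image)
    qed
    \<comment> \<open>Degrees are summed over M only, and each is at most \<open>deg v\<close> =
      \<open>card N\<close>. Doubled, this bounds the M-N pairs in both directions together with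
      twice the pairs inside M: once as pairs of H and once as monochromatic pairs of the new
      part.\<close>
    have degsum: "card {(x, y) \<in> M \<times> N. H x y} + card {(x, y) \<in> M \<times> M. H x y} \<le> card M * card N"
    proof -
      have "card {(x, y) \<in> M \<times> N. H x y} + card {(x, y) \<in> M \<times> M. H x y}
            = card ({(x, y) \<in> M \<times> N. H x y} \<union> {(x, y) \<in> M \<times> M. H x y})"
        by (subst card_Un_disjoint)
           (use disj fin in \<open>auto simp: finite_pairs\<close>)
      also have "{(x, y) \<in> M \<times> N. H x y} \<union> {(x, y) \<in> M \<times> M. H x y} = Sigma M (\<lambda>x. {y \<in> X. H x y})"
        using X by auto
      also have "card \<dots> = (\<Sum>x\<in>M. deg x)"
        using fin Suc.prems(1) by (simp add: deg_def)
      also have "\<dots> \<le> (\<Sum>x\<in>M. card N)"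
        by (rule sum_mono) (use vmax in \<open>auto simp: N_def M_def deg_def\<close>)
      finally show ?thesis by simp
    qed
    have Hs: "H x y = H y x" for x y using sympD[OF Suc.prems(2)] by blast
    have s1: "card {(x, y) \<in> X \<times> X. H x y} = card {(x, y) \<in> N \<times> N. H x y}
        + 2 * card {(x, y) \<in> M \<times> N. H x y} + card {(x, y) \<in> M \<times> M. H x y}"
      using split[of H] swap[of H, OF Hs] by linarith
    have dN: "\<And>x. x \<in> N \<Longrightarrow> d x = c x" and dM: "\<And>x. x \<in> M \<Longrightarrow> d x = Suc r"
      using disj by (auto simp: d_def)
    have cr': "\<And>x. x \<in> N \<Longrightarrow> Suc r \<noteq> c x" using cr by metis
    have e1: "{(x, y) \<in> N \<times> N. H x y \<and> d x = d y} = {(x, y) \<in> N \<times> N. H x y \<and> c x = c y}"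
      "{(x, y) \<in> N \<times> M. H x y \<and> d x = d y} = {}" "{(x, y) \<in> M \<times> N. H x y \<and> d x = d y} = {}"
      "{(x, y) \<in> M \<times> M. H x y \<and> d x = d y} = {(x, y) \<in> M \<times> M. H x y}"
      "{(x, y) \<in> N \<times> N. d x \<noteq> d y} = {(x, y) \<in> N \<times> N. c x \<noteq> c y}"
      "{(x, y) \<in> N \<times> M. d x \<noteq> d y} = N \<times> M" "{(x, y) \<in> M \<times> N. d x \<noteq> d y} = M \<times> N"
      "{(x, y) \<in> M \<times> M. d x \<noteq> d y} = {}"
      by (auto simp: dN dM cr cr')
    have s2: "card {(x, y) \<in> X \<times> X. H x y \<and> d x = d y}
        = card {(x, y) \<in> N \<times> N. H x y \<and> c x = c y} + card {(x, y) \<in> M \<times> M. H x y}"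
      using split[of "\<lambda>x y. H x y \<and> d x = d y"] unfolding e1 card.empty by linarith
    have s3: "card {(x, y) \<in> X \<times> X. d x \<noteq> d y}
        = card {(x, y) \<in> N \<times> N. c x \<noteq> c y} + 2 * (card M * card N)"
      using split[of "\<lambda>x y. d x \<noteq> d y"] unfolding e1 card.empty by (simp add: mult.commute card_cartesian_product)
    have "d ` X \<subseteq> {1..Suc r}" using c(1) by (auto simp: d_def)
    moreover have "card {(x, y) \<in> X \<times> X. H x y} + card {(x, y) \<in> X \<times> X. H x y \<and> d x = d y}
       \<le> card {(x, y) \<in> X \<times> X. d x \<noteq> d y}"
      using s1 s2 s3 c(2) degsum by linarith
    ultimately show ?thesis by blast
  qed simp
qed

text \<open>For a = k div r every summand of the correction term is nonnegative, and it vanishes iff the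
  colour class has size a or a + 1.\<close>

lemma card_bichromatic_pairs:
  fixes c :: "'a \<Rightarrow> nat" and a :: int
  assumes "finite X" "c ` X \<subseteq> {1..r}"
  shows "int (card {(x, y) \<in> X \<times> X. c x \<noteq> c y}) =
     int (card X)^2 - (2 * a + 1) * int (card X) + int r * (a * (a + 1))
     - (\<Sum>i\<in>{1..r}. (int (card {x \<in> X. c x = i}) - a) * (int (card {x \<in> X. c x = i}) - (a + 1)))"
proof -
  define s where "s i = card {x \<in> X. c x = i}" for i
  have eqsum: "card X = (\<Sum>i\<in>{1..r}. s i)"
    unfolding s_def by (subst card_UN_disjoint[symmetric]) (use assms in \<open>auto intro!: arg_cong[of _ _ card]\<close>)
  have "{(x, y) \<in> X \<times> X. c x = c y} = (\<Union>i\<in>{1..r}. {x \<in> X. c x = i} \<times> {x \<in> X. c x = i})"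
    using assms by auto
  also have "card \<dots> = (\<Sum>i\<in>{1..r}. s i * s i)"
    unfolding s_def by (subst card_UN_disjoint) (use assms in \<open>auto simp: card_cartesian_product\<close>)
  finally have mono: "card {(x, y) \<in> X \<times> X. c x = c y} = (\<Sum>i\<in>{1..r}. s i * s i)" .
  have "card {(x, y) \<in> X \<times> X. c x \<noteq> c y} + card {(x, y) \<in> X \<times> X. c x = c y}
      = card ({(x, y) \<in> X \<times> X. c x \<noteq> c y} \<union> {(x, y) \<in> X \<times> X. c x = c y})"
    by (subst card_Un_disjoint) (use assms in \<open>auto simp: finite_pairs\<close>)
  also have "{(x, y) \<in> X \<times> X. c x \<noteq> c y} \<union> {(x, y) \<in> X \<times> X. c x = c y} = X \<times> X" by auto
  finally have tot: "int (card {(x, y) \<in> X \<times> X. c x \<noteq> c y}) + (\<Sum>i\<in>{1..r}. int (s i) * int (s i)) = int (card X)^2"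
    unfolding mono by (simp add: power2_eq_square card_cartesian_product flip: of_nat_mult of_nat_sum of_nat_add)
  have "(\<Sum>i\<in>{1..r}. (int (s i) - a) * (int (s i) - (a + 1)))
     = (\<Sum>i\<in>{1..r}. int (s i) * int (s i) - (2 * a + 1) * int (s i) + a * (a + 1))"
    by (intro sum.cong) (auto simp: algebra_simps)
  also have "\<dots> = (\<Sum>i\<in>{1..r}. int (s i) * int (s i)) - (2 * a + 1) * int (card X) + int r * (a * (a + 1))"
    by (simp add: sum.distrib sum_subtractf eqsum sum_distrib_left)
  finally show ?thesis using tot unfolding s_def by simp
qed

lemma card_ordered_edges:
  assumes "finite X" "\<And>e. e \<in> E \<Longrightarrow> e \<subseteq> X \<and> card e = 2"
  shows "card {(x, y) \<in> X \<times> X. {x, y} \<in> E} = 2 * card E"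
proof -
  have finE: "finite E" by (rule finite_subset[of _ "Pow X"]) (use assms in auto)
  have "{(x, y) \<in> X \<times> X. {x, y} \<in> E} = (\<Union>e\<in>E. {(x, y). {x, y} = e})"
    using assms(2) by auto
  also have "card \<dots> = (\<Sum>e\<in>E. card {(x, y). {x, y} = e})"
  proof (rule card_UN_disjoint[OF finE])
    show "\<forall>e\<in>E. finite {(x, y). {x, y} = e}"
    proof
      fix e assume "e \<in> E"
      then have "finite (e \<times> e)" using assms finite_subset by blast
      then show "finite {(x, y). {x, y} = e}" by (rule rev_finite_subset) auto
    qed
  qed auto
  also have "\<dots> = (\<Sum>e\<in>E. 2)"
  proof (rule sum.cong)
    fix e assume "e \<in> E"
    then obtain a b where ab: "e = {a, b}" "a \<noteq> b" using assms(2) card_2_iff by metis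
    then have "{(x, y). {x, y} = e} = {(a, b), (b, a)}" by (auto simp: doubleton_eq_iff)
    then show "card {(x, y). {x, y} = e} = 2" using ab(2) by simp
  qed simp
  finally show ?thesis by simp
qed

lemma card_residue_class:
  fixes k q r :: nat
  assumes "q < r"
  shows "card {v \<in> {1..k}. v mod r = q} \<in> {k div r, k div r + 1}"
proof -
  let ?C = "{v \<in> {1..k}. v mod r = q}"
  have "inj_on (\<lambda>v. v div r) ?C"
  proof (rule inj_onI)
    fix x y assume "x \<in> ?C" "y \<in> ?C" "x div r = y div r"
    then show "x = y" using div_mult_mod_eq[of x r] div_mult_mod_eq[of y r] by simp
  qed
  moreover have "(\<lambda>v. v div r) ` ?C \<subseteq> {0..k div r}" by (auto intro: div_le_mono)
  ultimately have "card ?C \<le> card {0..k div r}" by (rule card_inj_on_le) simp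
  moreover have "card {1..k div r} \<le> card ?C"
  proof (rule card_inj_on_le)
    \<comment> \<open>The m-th positive integer congruent to q: counting starts at 1, so residue 0
      first occurs at r, every other residue at q itself.\<close>
    let ?f = "\<lambda>m. if q = 0 then r * m else r * (m - 1) + q"
    show "inj_on ?f {1..k div r}" using assms by (auto simp: inj_on_def)
    show "?f ` {1..k div r} \<subseteq> ?C"
    proof
      fix v assume "v \<in> ?f ` {1..k div r}"
      then obtain m where m: "1 \<le> m" "m \<le> k div r" "v = ?f m"
        by (elim imageE) (metis atLeastAtMost_iff)
      have rm: "r * m \<le> k" using m(2) by (metis div_times_less_eq_dividend le_trans mult.commute mult_le_mono2)
      have "r * m = r * (m - 1) + r" using m(1) by (cases m) auto
      then show "v \<in> ?C" using m rm assms by (auto simp: Suc_le_eq)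
    qed
  qed simp
  ultimately show ?thesis by auto
qed

text \<open>Residue classes have size \<open>k div r\<close> or one more, so the correction term of
  \<open>card_bichromatic_pairs\<close> vanishes. The factor 2 reflects the count of ordered
  pairs.\<close>

lemma turan_edges_eq:
  assumes "0 < r"
  shows "2 * int (turan_edges r k) =
     int k ^ 2 - (2 * int (k div r) + 1) * int k + int r * (int (k div r) * (int (k div r) + 1))"
proof -
  \<comment> \<open>Residue 0 is renamed r, so that the colours range over {1..r}.\<close>
  let ?c = "\<lambda>v. if v mod r = 0 then r else v mod r"
  have ci: "?c v = i \<longleftrightarrow> v mod r = i mod r" if "i \<in> {1..r}" for i v
  proof -
    have "v mod r < r" using assms by simp
    then show ?thesis using that by (cases "i = r") auto
  qed
  have rng: "?c v \<in> {1..r}" for v using assms by (auto simp: Suc_le_eq less_imp_le)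
  let ?E = "edges (turan_graph r k)"
  have mem: "{x, y} \<in> ?E \<longleftrightarrow> x \<in> {1..k} \<and> y \<in> {1..k} \<and> ?c x \<noteq> ?c y" for x y
  proof
    assume "{x, y} \<in> ?E"
    then obtain u v i j where uv: "{x, y} = {u, v}" "i \<in> {1..r}" "j \<in> {1..r}" "i \<noteq> j"
       "u \<in> {1..k}" "u mod r = i mod r" "v \<in> {1..k}" "v mod r = j mod r"
      unfolding turan_graph_def complete_multipartite_def by auto
    have "?c u = i" "?c v = j" using ci uv by blast+
    then show "x \<in> {1..k} \<and> y \<in> {1..k} \<and> ?c x \<noteq> ?c y"
      using uv by (metis (no_types, lifting) doubleton_eq_iff)
  next
    assume a: "x \<in> {1..k} \<and> y \<in> {1..k} \<and> ?c x \<noteq> ?c y"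
    have "x mod r = ?c x mod r" "y mod r = ?c y mod r" using ci rng by blast+
    then show "{x, y} \<in> ?E"
      unfolding turan_graph_def complete_multipartite_def snd_conv mem_Collect_eq
      using rng[of x] rng[of y] a
      by (intro exI[of _ x] exI[of _ y] conjI refl bexI[of _ "?c x"] bexI[of _ "?c y"]) blast+
  qed
  have "card {(x, y) \<in> {1..k} \<times> {1..k}. {x, y} \<in> ?E} = 2 * turan_edges r k"
    unfolding turan_edges_def
  proof (rule card_ordered_edges)
    fix e assume e: "e \<in> ?E"
    then obtain x y where xy: "e = {x, y}"
      unfolding turan_graph_def complete_multipartite_def by auto
    with e mem[of x y] show "e \<subseteq> {1..k} \<and> card e = 2" by (auto simp: card_2_iff)
  qed simp
  moreover have "{(x, y) \<in> {1..k} \<times> {1..k}. {x, y} \<in> ?E} = {(x, y) \<in> {1..k} \<times> {1..k}. ?c x \<noteq> ?c y}"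
    using mem by auto
  moreover have "(\<Sum>i\<in>{1..r}. (int (card {x \<in> {1..k}. ?c x = i}) - int (k div r)) *
      (int (card {x \<in> {1..k}. ?c x = i}) - (int (k div r) + 1))) = 0"
  proof (rule sum.neutral, rule ballI)
    fix i assume i: "i \<in> {1..r}"
    have "{x \<in> {1..k}. ?c x = i} = {x \<in> {1..k}. x mod r = i mod r}" using ci[OF i] by blast
    then show "(int (card {x \<in> {1..k}. ?c x = i}) - int (k div r)) *
      (int (card {x \<in> {1..k}. ?c x = i}) - (int (k div r) + 1)) = 0"
      using card_residue_class[of "i mod r" r k] assms by auto
  qed
  moreover have "?c ` {1..k} \<subseteq> {1..r}" using rng by blast
  ultimately show ?thesis
    using card_bichromatic_pairs[of "{1..k}" ?c r "int (k div r)"] by simp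
qed

text \<open>How many colours have the larger size is not prescribed: the sizes add up to k, so it
  must be \<open>k mod r\<close> of them.\<close>

definition balanced_colouring :: "nat \<Rightarrow> nat \<Rightarrow> (nat \<Rightarrow> nat) \<Rightarrow> bool" where
  "balanced_colouring r k c \<longleftrightarrow> c ` {1..k} \<subseteq> {1..r} \<and>
     (\<forall>i\<in>{1..r}. card {j \<in> {1..k}. c j = i} \<in> {k div r, k div r + 1})"

text \<open>The instance i = j makes H irreflexive on {1..k}.\<close>

definition is_turan :: "nat \<Rightarrow> nat \<Rightarrow> (nat \<Rightarrow> nat \<Rightarrow> bool) \<Rightarrow> bool" where
  "is_turan r k H \<longleftrightarrow> (\<exists>c. balanced_colouring r k c \<and>
     (\<forall>i\<in>{1..k}. \<forall>j\<in>{1..k}. H i j \<longleftrightarrow> c i \<noteq> c j))"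

text \<open>The edge count falls short of the Turan number by at least the monochromatic pairs of
  the partition plus its imbalance \<open>f\<close>. Both are nonnegative, so equality forces both
  to vanish: H is then complete multipartite with balanced classes.\<close>

lemma turan_bound_and_uniqueness:
  assumes "0 < r" "symp H" "irreflp H"
    and "\<And>K. K \<subseteq> {1..k} \<Longrightarrow> card K = Suc r \<Longrightarrow> \<not> pairwise H K"
  shows "card {(x, y) \<in> {1..k} \<times> {1..k}. H x y} \<le> 2 * turan_edges r k"
    and "card {(x, y) \<in> {1..k} \<times> {1..k}. H x y} = 2 * turan_edges r k \<Longrightarrow> is_turan r k H"
proof -
  let ?X = "{1..k}"
  let ?a = "int (k div r)"
  obtain c where c: "c ` ?X \<subseteq> {1..r}"
    "card {(x, y) \<in> ?X \<times> ?X. H x y} + card {(x, y) \<in> ?X \<times> ?X. H x y \<and> c x = c y}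
       \<le> card {(x, y) \<in> ?X \<times> ?X. c x \<noteq> c y}"
    using furedi_partition[of ?X H r] assms(2-4) by blast
  define f where "f i = (int (card {x \<in> ?X. c x = i}) - ?a) * (int (card {x \<in> ?X. c x = i}) - (?a + 1))" for i
  \<comment> \<open>The product of two consecutive integers is nonnegative, and zero only if one of
    them is zero.\<close>
  have f0: "f i \<ge> 0" for i
    unfolding f_def by (cases "int (card {x \<in> ?X. c x = i}) \<le> ?a") (auto intro: mult_nonpos_nonpos)
  have eq: "int (card {(x, y) \<in> ?X \<times> ?X. c x \<noteq> c y}) = 2 * int (turan_edges r k) - (\<Sum>i\<in>{1..r}. f i)"
    using card_bichromatic_pairs[OF _ c(1), of ?a] turan_edges_eq[OF assms(1), of k] by (simp add: f_def)
  have s0: "(\<Sum>i\<in>{1..r}. f i) \<ge> 0" by (rule sum_nonneg) (rule f0)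
  show "card {(x, y) \<in> ?X \<times> ?X. H x y} \<le> 2 * turan_edges r k" using c(2) eq s0 by linarith
  assume e: "card {(x, y) \<in> ?X \<times> ?X. H x y} = 2 * turan_edges r k"
  have z: "(\<Sum>i\<in>{1..r}. f i) = 0" and z1: "card {(x, y) \<in> ?X \<times> ?X. H x y \<and> c x = c y} = 0"
    and z2: "card {(x, y) \<in> ?X \<times> ?X. c x \<noteq> c y} = card {(x, y) \<in> ?X \<times> ?X. H x y}"
    using c(2) eq s0 e by linarith+
  have fin: "finite {(x, y) \<in> ?X \<times> ?X. P x y}" for P
    by (rule finite_subset[of _ "?X \<times> ?X"]) auto
  have "{(x, y) \<in> ?X \<times> ?X. H x y \<and> c x = c y} = {}" using z1 fin by (simp only: card_eq_0_iff) auto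
  then have "{(x, y) \<in> ?X \<times> ?X. H x y} \<subseteq> {(x, y) \<in> ?X \<times> ?X. c x \<noteq> c y}" by auto
  then have "{(x, y) \<in> ?X \<times> ?X. H x y} = {(x, y) \<in> ?X \<times> ?X. c x \<noteq> c y}"
    by (rule card_subset_eq[OF fin _ z2[symmetric]])
  then have "\<forall>i\<in>?X. \<forall>j\<in>?X. H i j \<longleftrightarrow> c i \<noteq> c j" by auto
  moreover have "card {j \<in> ?X. c j = i} \<in> {k div r, k div r + 1}" if "i \<in> {1..r}" for i
  proof -
    have "f i = 0" using z that f0 sum_nonneg_eq_0_iff[of "{1..r}" f] by auto
    then show ?thesis unfolding f_def by auto
  qed
  ultimately show "is_turan r k H"
    unfolding is_turan_def balanced_colouring_def using c(1) by blast
qed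

subsection \<open>Supersaturation and random transversals\<close>

lemma sum_card_swap:
  assumes "finite X" "finite Y"
  shows "(\<Sum>y\<in>Y. card {x \<in> X. P y x}) = (\<Sum>x\<in>X. card {y \<in> Y. P y x})"
proof -
  have "(\<Sum>y\<in>Y. card {x \<in> X. P y x}) = (\<Sum>y\<in>Y. \<Sum>x\<in>X. if P y x then 1 else 0)"
    using assms by (intro sum.cong refl) (simp add: sum.If_cases Int_def)
  also have "\<dots> = (\<Sum>x\<in>X. \<Sum>y\<in>Y. if P y x then 1 else 0)" by (rule sum.swap)
  also have "\<dots> = (\<Sum>x\<in>X. card {y \<in> Y. P y x})"
    using assms by (intro sum.cong refl) (simp add: sum.If_cases Int_def)
  finally show ?thesis .
qed

text \<open>Only m elements of Y of large degree are kept, with m depending on \<delta> and t alone.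
  The pigeonhole then runs over at most 2^m sets T, so \<delta>' is independent of the size of Y, as
  the induction over the classes requires.\<close>

lemma dense_relation_common_neighbours:
  fixes \<delta> :: real and t :: nat
  assumes "\<delta> > 0"
  shows "\<exists>\<delta>'>0. \<exists>N. \<forall>(X :: 'a set) (Y :: 'b set) P. finite X \<longrightarrow> finite Y \<longrightarrow> N \<le> card Y \<longrightarrow>
    \<delta> * (real (card Y) * real (card X)) \<le> real (\<Sum>y\<in>Y. card {x \<in> X. P y x}) \<longrightarrow>
    (\<exists>T\<subseteq>Y. card T = t \<and> \<delta>' * real (card X) \<le> real (card {x \<in> X. \<forall>y\<in>T. P y x}))"
proof -
  \<comment> \<open>Since 4 t \<le> \<delta> m, elements of X with fewer than t neighbours in M
    account for at most half of the incidences that the large degrees guarantee.\<close>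
  define m where "m = nat \<lceil>4 * real t / \<delta>\<rceil> + 1"
  have m0: "m > 0" by (simp add: m_def)
  have "4 * real t / \<delta> \<le> real m" unfolding m_def by linarith
  then have mt: "4 * real t \<le> \<delta> * real m" using assms by (simp add: field_simps)
  \<comment> \<open>Half of the proportion \<delta> / 4 of elements in \<open>X1\<close>, shared
    among at most 2^m sets T; the half makes the final contradiction strict.\<close>
  define \<delta>' where "\<delta>' = \<delta> / (8 * 2 ^ m)"
  \<comment> \<open>The first summand forces m elements of large degree; the second supplies a
    t-subset of Y even if X is empty.\<close>
  define N where "N = nat \<lceil>2 * real m / \<delta>\<rceil> + t"
  show ?thesis
  proof (intro exI[of _ \<delta>'] conjI exI[of _ N] allI impI)
    show "\<delta>' > 0" using assms by (simp add: \<delta>'_def)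
    fix X :: "'a set" and Y :: "'b set" and P
    assume fX: "finite X" and fY: "finite Y" and NY: "N \<le> card Y"
      and dens: "\<delta> * (real (card Y) * real (card X)) \<le> real (\<Sum>y\<in>Y. card {x \<in> X. P y x})"
    have "2 * real m / \<delta> \<le> real N" "t \<le> N" unfolding N_def by linarith+
    then have mY: "2 * real m \<le> \<delta> * real (card Y)" and tY: "t \<le> card Y"
      using NY assms by (simp_all add: field_simps) (smt (verit) mult_left_mono of_nat_le_iff)
    show "\<exists>T\<subseteq>Y. card T = t \<and> \<delta>' * real (card X) \<le> real (card {x \<in> X. \<forall>y\<in>T. P y x})"
    proof (cases "X = {}")
      case True
      obtain T where "T \<subseteq> Y" "card T = t" using tY obtain_subset_with_card_n by metis
      then show ?thesis using True by auto
    next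
      case False
      define x where "x = real (card X)"
      have x0: "x > 0" using False fX by (auto simp: x_def card_gt_0_iff)
      define deg where "deg y = card {x \<in> X. P y x}" for y
      define Y1 where "Y1 = {y \<in> Y. \<delta> / 2 * x \<le> real (deg y)}"
      have degX: "real (deg y) \<le> x" for y
        unfolding deg_def x_def using fX by (auto intro: card_mono)
      have "\<delta> * (real (card Y) * x) \<le> (\<Sum>y\<in>Y. real (deg y))"
        using dens by (simp add: deg_def x_def)
      also have "\<dots> \<le> (\<Sum>y\<in>Y. (if y \<in> Y1 then x else 0) + \<delta> / 2 * x)"
        using degX x0 assms by (intro sum_mono) (auto simp: Y1_def intro: add_increasing2)
      also have "\<dots> = real (card Y1) * x + real (card Y) * (\<delta> / 2 * x)"
        using fY by (simp add: sum.distrib sum.If_cases Y1_def Int_def)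
      finally have "\<delta> / 2 * real (card Y) * x \<le> real (card Y1) * x" by (simp add: field_simps)
      then have "\<delta> / 2 * real (card Y) \<le> real (card Y1)" using x0 by simp
      then have "m \<le> card Y1" using mY by linarith
      then obtain M where M: "M \<subseteq> Y1" "card M = m" using obtain_subset_with_card_n by metis
      have fM: "finite M" using M m0 card_ge_0_finite by metis
      define X1 where "X1 = {x \<in> X. t \<le> card {y \<in> M. P y x}}"
      have "real m * (\<delta> / 2 * x) = (\<Sum>y\<in>M. \<delta> / 2 * x)" using M by simp
      also have "\<dots> \<le> (\<Sum>y\<in>M. real (deg y))" using M by (intro sum_mono) (auto simp: Y1_def)
      also have "\<dots> = real (\<Sum>y\<in>M. card {x \<in> X. P y x})" by (simp add: deg_def)
      also have "\<dots> = real (\<Sum>x\<in>X. card {y \<in> M. P y x})" by (simp only: sum_card_swap[OF fX fM])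
      also have "\<dots> \<le> (\<Sum>x\<in>X. (if x \<in> X1 then real m else 0) + real t)"
        unfolding of_nat_sum
      proof (rule sum_mono)
        fix x assume "x \<in> X"
        have "card {y \<in> M. P y x} \<le> m" using M(2) fM card_mono[of M "{y \<in> M. P y x}"] by auto
        then show "real (card {y \<in> M. P y x}) \<le> (if x \<in> X1 then real m else 0) + real t"
          using \<open>x \<in> X\<close> by (auto simp: X1_def)
      qed
      also have "\<dots> = real (card X1) * real m + x * real t"
        using fX by (simp add: sum.distrib sum.If_cases X1_def Int_def x_def)
      finally have "real m * (\<delta> / 2 * x) \<le> real (card X1) * real m + x * real t" .
      moreover have "4 * (x * real t) \<le> \<delta> * real m * x" using mult_right_mono[OF mt, of x] x0 by (simp add: ac_simps)
      ultimately have "real m * (\<delta> / 4 * x) \<le> real m * real (card X1)" by (simp add: field_simps)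
      then have X1: "\<delta> / 4 * x \<le> real (card X1)" using m0 by simp
      define F where "F = {T. T \<subseteq> M \<and> card T = t}"
      have fF: "finite F" unfolding F_def using fM by simp
      have "card F \<le> card (Pow M)" unfolding F_def using fM by (intro card_mono) auto
      then have "card F \<le> 2 ^ m" using fM M(2) by (simp add: card_Pow)
      then have "real (card F) \<le> real (2 ^ m)" by (simp only: of_nat_le_iff)
      then have cF: "real (card F) \<le> 2 ^ m" by simp
      have "\<exists>T\<in>F. \<delta>' * x \<le> real (card {x \<in> X. \<forall>y\<in>T. P y x})"
      proof (rule ccontr)
        assume "\<not> ?thesis"
        then have small: "real (card {x \<in> X. \<forall>y\<in>T. P y x}) \<le> \<delta>' * x" if "T \<in> F" for T
          using that by fastforce
        have "X1 \<subseteq> (\<Union>T\<in>F. {x \<in> X. \<forall>y\<in>T. P y x})"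
        proof
          fix z assume z: "z \<in> X1"
          then have "t \<le> card {y \<in> M. P y z}" by (simp add: X1_def)
          then obtain T where "T \<subseteq> {y \<in> M. P y z}" "card T = t"
            using obtain_subset_with_card_n by metis
          then show "z \<in> (\<Union>T\<in>F. {x \<in> X. \<forall>y\<in>T. P y x})"
            using z by (auto simp: F_def X1_def)
        qed
        then have "card X1 \<le> card (\<Union>T\<in>F. {x \<in> X. \<forall>y\<in>T. P y x})"
          using fF fX by (intro card_mono) auto
        also have "\<dots> \<le> (\<Sum>T\<in>F. card {x \<in> X. \<forall>y\<in>T. P y x})" using fF by (rule card_UN_le)
        finally have "real (card X1) \<le> (\<Sum>T\<in>F. real (card {x \<in> X. \<forall>y\<in>T. P y x}))"
          by (simp flip: of_nat_sum)
        also have "\<dots> \<le> (\<Sum>T\<in>F. \<delta>' * x)" by (rule sum_mono) (rule small)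
        also have "\<dots> \<le> 2 ^ m * (\<delta>' * x)"
          using cF x0 \<open>\<delta>' > 0\<close> by (simp add: mult_right_mono)
        also have "\<dots> = \<delta> / 8 * x" by (simp add: \<delta>'_def)
        finally show False using X1 mult_pos_pos[OF assms x0] by simp
      qed
      then obtain T where "T \<in> F" "\<delta>' * x \<le> real (card {x \<in> X. \<forall>y\<in>T. P y x})" by blast
      then show ?thesis using M(1) by (intro exI[of _ T]) (auto simp: F_def Y1_def x_def)
    qed
  qed
qed

text \<open>Erdos's theorem on dense partite hypergraphs; the hyperedges are the choice functions
  satisfying P.\<close>

lemma dense_choices_contain_box:
  fixes \<delta> :: real and t :: nat and J :: "'i set"
  assumes "finite J" "\<delta> > 0"
  shows "\<exists>N. \<forall>n\<ge>N. \<forall>(V :: 'i \<Rightarrow> 'v set) P. (\<forall>j\<in>J. finite (V j) \<and> card (V j) = n) \<longrightarrow>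
    \<delta> * real n ^ card J \<le> real (card {x \<in> PiE J V. P x}) \<longrightarrow>
    (\<exists>T. (\<forall>j\<in>J. T j \<subseteq> V j \<and> card (T j) = t) \<and> (\<forall>x\<in>PiE J T. P x))"
  using assms
proof (induction J arbitrary: \<delta> rule: finite_induct)
  case empty
  have "P (\<lambda>_. undefined)" if "\<delta> * real n ^ card {} \<le> real (card {x \<in> PiE {} V. P x})"
    for n and V :: "'i \<Rightarrow> 'v set" and P
  proof (rule ccontr)
    assume "\<not> ?thesis"
    then have "{x \<in> PiE {} V. P x} = {}" by auto
    then have z: "card {x \<in> PiE {} V. P x} = 0" by (simp only: card.empty)
    show False using that empty unfolding z by simp
  qed
  then show ?case by auto
next
  case (insert i J)
  obtain \<delta>' N1 where \<delta>': "\<delta>' > 0" and N1: "\<forall>(X :: ('i \<Rightarrow> 'v) set) (Y :: 'v set) P.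
    finite X \<longrightarrow> finite Y \<longrightarrow> N1 \<le> card Y \<longrightarrow>
    \<delta> * (real (card Y) * real (card X)) \<le> real (\<Sum>y\<in>Y. card {x \<in> X. P y x}) \<longrightarrow>
    (\<exists>T\<subseteq>Y. card T = t \<and> \<delta>' * real (card X) \<le> real (card {x \<in> X. \<forall>y\<in>T. P y x}))"
    using dense_relation_common_neighbours[OF insert.prems, of t] by (elim exE conjE)
  from insert.IH[OF \<delta>'] obtain N2 where N2: "\<forall>n\<ge>N2. \<forall>(V :: 'i \<Rightarrow> 'v set) P.
    (\<forall>j\<in>J. finite (V j) \<and> card (V j) = n) \<longrightarrow>
    \<delta>' * real n ^ card J \<le> real (card {x \<in> PiE J V. P x}) \<longrightarrow>
    (\<exists>T. (\<forall>j\<in>J. T j \<subseteq> V j \<and> card (T j) = t) \<and> (\<forall>x\<in>PiE J T. P x))"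
    by (elim exE)
  show ?case
  proof (intro exI[of _ "max N1 N2"] allI impI)
    fix n and V :: "'i \<Rightarrow> 'v set" and P
    assume n: "max N1 N2 \<le> n" and V: "\<forall>j\<in>insert i J. finite (V j) \<and> card (V j) = n"
      and dens: "\<delta> * real n ^ card (insert i J) \<le> real (card {x \<in> PiE (insert i J) V. P x})"
    have fin: "finite (PiE J V)" using V insert.hyps by (intro finite_PiE) auto
    have cJ: "card (PiE J V) = n ^ card J" using V insert.hyps by (simp add: card_PiE)
    have "{x \<in> PiE (insert i J) V. P x} =
       (\<lambda>(y, x). x(i := y)) ` Sigma (V i) (\<lambda>y. {x \<in> PiE J V. P (x(i := y))})"
      unfolding PiE_insert_eq by auto
    also have "card \<dots> = card (Sigma (V i) (\<lambda>y. {x \<in> PiE J V. P (x(i := y))}))"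
      by (rule card_image, rule inj_on_subset[OF inj_combinator[OF insert.hyps(2), of V]]) auto
    also have "\<dots> = (\<Sum>y\<in>V i. card {x \<in> PiE J V. P (x(i := y))})"
      using V fin by simp
    finally have "\<delta> * (real (card (V i)) * real (card (PiE J V)))
       \<le> real (\<Sum>y\<in>V i. card {x \<in> PiE J V. P (x(i := y))})"
      using dens V insert.hyps cJ by simp
    then obtain T0 where T0: "T0 \<subseteq> V i" "card T0 = t"
      "\<delta>' * real (card (PiE J V)) \<le> real (card {x \<in> PiE J V. \<forall>y\<in>T0. P (x(i := y))})"
      using N1[rule_format, OF fin, of "V i" "\<lambda>y x. P (x(i := y))"] V n by auto
    \<comment> \<open>The induction hypothesis is applied to the predicate that demands P for all of
      \<open>T0\<close> at once, so the box found on J can be extended by \<open>T0\<close> as its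
      side at i.\<close>
    then obtain T where T: "\<forall>j\<in>J. T j \<subseteq> V j \<and> card (T j) = t"
      "\<forall>x\<in>PiE J T. \<forall>y\<in>T0. P (x(i := y))"
      using N2[rule_format, of n V "\<lambda>x. \<forall>y\<in>T0. P (x(i := y))"] V n cJ by auto
    have "PiE J (T(i := T0)) = PiE J T" using insert.hyps(2) by (intro PiE_cong) auto
    then have "\<forall>x\<in>PiE (insert i J) (T(i := T0)). P x"
      using T(2) unfolding PiE_insert_eq by auto
    then show "\<exists>T. (\<forall>j\<in>insert i J. T j \<subseteq> V j \<and> card (T j) = t) \<and> (\<forall>x\<in>PiE (insert i J) T. P x)"
      using T(1) T0 insert.hyps(2) by (intro exI[of _ "T(i := T0)"]) auto
  qed
qed

text \<open>Each pair (x, y) extends to \<open>n ^ (card I - 2)\<close> choices, so proportions of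
  pairs and of choices agree. Cross-multiplying avoids division and truncated subtraction.\<close>

lemma card_choices_pair:
  fixes V :: "'i \<Rightarrow> 'v set"
  assumes "finite I" "i \<in> I" "j \<in> I" "i \<noteq> j" "\<forall>l\<in>I. finite (V l) \<and> card (V l) = n"
  shows "card {v \<in> PiE I V. P (v i) (v j)} * n ^ 2 = card {(x, y) \<in> V i \<times> V j. P x y} * n ^ card I"
proof -
  let ?S = "{(x, y) \<in> V i \<times> V j. P x y}"
  let ?F = "\<lambda>(x, y). PiE I (V(i := {x}, j := {y}))"
  have fS: "finite ?S" using assms by (simp add: finite_pairs)
  have one: "card (?F p) * n ^ 2 = n ^ card I" if "p \<in> ?S" for p :: "'v \<times> 'v"
  proof -
    obtain x y where p: "p = (x, y)" by (cases p)
    have "card (PiE I (V(i := {x}, j := {y}))) = (\<Prod>l\<in>I. card ((V(i := {x}, j := {y})) l))"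
      using assms(1) by (rule card_PiE)
    also have "\<dots> = (\<Prod>l\<in>I - {i} - {j}. card ((V(i := {x}, j := {y})) l))"
      using assms by (simp add: prod.remove[of I i] prod.remove[of "I - {i}" j])
    also have "\<dots> = (\<Prod>l\<in>I - {i} - {j}. n)"
      using assms by (intro prod.cong) auto
    also have "\<dots> = n ^ card (I - {i} - {j})" by simp
    finally have "card (?F p) * n ^ 2 = n ^ (card (I - {i} - {j}) + 2)" by (simp add: p power_add power2_eq_square)
    also have "card (I - {i} - {j}) + 2 = card I"
      using assms card_Suc_Diff1[of I i] card_Suc_Diff1[of "I - {i}" j] by simp
    finally show ?thesis .
  qed
  have "{v \<in> PiE I V. P (v i) (v j)} = (\<Union>p\<in>?S. ?F p)"
  proof (intro equalityI subsetI)
    fix v assume v: "v \<in> {v \<in> PiE I V. P (v i) (v j)}"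
    then have "(v i, v j) \<in> ?S" using assms by auto
    moreover have "v \<in> ?F (v i, v j)" using v assms by (auto simp: PiE_iff)
    ultimately show "v \<in> (\<Union>p\<in>?S. ?F p)" by blast
  next
    fix v assume "v \<in> (\<Union>p\<in>?S. ?F p)"
    then obtain x y where xy: "x \<in> V i" "y \<in> V j" "P x y" "v \<in> PiE I (V(i := {x}, j := {y}))" by auto
    have vi: "v i = x" "v j = y" using PiE_mem[OF xy(4)] assms by force+
    have "v l \<in> V l" if "l \<in> I" for l
      using PiE_mem[OF xy(4) that] xy vi by (auto split: if_splits)
    then show "v \<in> {v \<in> PiE I V. P (v i) (v j)}" using vi xy by (auto simp: PiE_iff)
  qed
  also have "card \<dots> = (\<Sum>p\<in>?S. card (?F p))"
  proof (rule card_UN_disjoint[OF fS])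
    show "\<forall>p\<in>?S. finite (?F p)"
      using assms by (auto intro!: finite_PiE)
    show "\<forall>p\<in>?S. \<forall>q\<in>?S. p \<noteq> q \<longrightarrow> ?F p \<inter> ?F q = {}"
    proof (intro ballI impI)
      fix p q :: "'v \<times> 'v" assume "p \<noteq> q"
      moreover have "p = q" if "v \<in> ?F p" "v \<in> ?F q" for v
      proof -
        obtain x y x' y' where pq: "p = (x, y)" "q = (x', y')" by (cases p, cases q)
        have "v \<in> PiE I (V(i := {x}, j := {y}))" "v \<in> PiE I (V(i := {x'}, j := {y'}))"
          using that pq by auto
        from PiE_mem[OF this(1)] PiE_mem[OF this(2)] show "p = q"
          using assms(2-4) pq by force
      qed
      ultimately show "?F p \<inter> ?F q = {}" by blast
    qed
  qed
  finally have "card {v \<in> PiE I V. P (v i) (v j)} * n ^ 2 = (\<Sum>p\<in>?S. card (?F p) * n ^ 2)"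
    by (simp only: sum_distrib_right)
  also have "\<dots> = (\<Sum>p\<in>?S. n ^ card I)" by (rule sum.cong[OF refl one])
  finally show ?thesis by simp
qed

definition mix :: "nat set \<Rightarrow> (nat \<Rightarrow> 'v) \<Rightarrow> (nat \<Rightarrow> 'v) \<Rightarrow> nat \<Rightarrow> 'v" where
  "mix A v w = (\<lambda>j. if j \<in> A then v j else w j)"

lemma mix_in_PiE: "v \<in> PiE I V \<Longrightarrow> w \<in> PiE I V \<Longrightarrow> mix A v w \<in> PiE I V"
  by (auto simp: mix_def PiE_iff extensional_def)

text \<open>For fixed A, the map from (v, w) to (\<open>mix A v w\<close>, \<open>mix A w v\<close>)
  is an involution on pairs, so a mixture of two uniform choices is again uniform. A union bound
  over the 2^\<open>card I\<close> sets A and averaging over v give the claim.\<close>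

lemma exists_choice_with_good_mixtures:
  assumes "finite I" "finite (PiE I V)" "PiE I V \<noteq> {}"
    and "real (card {v \<in> PiE I V. \<not> Q v}) \<le> \<beta> * real (card (PiE I V))"
  shows "\<exists>v\<in>PiE I V. real (card {w \<in> PiE I V. \<exists>A\<subseteq>I. \<not> Q (mix A v w)})
     \<le> 2 ^ card I * \<beta> * real (card (PiE I V))"
proof (rule ccontr)
  let ?O = "PiE I V"
  assume "\<not> ?thesis"
  then have big: "2 ^ card I * \<beta> * real (card ?O) < real (card {w \<in> ?O. \<exists>A\<subseteq>I. \<not> Q (mix A v w)})"
    if "v \<in> ?O" for v using that by force
  have one: "card {(v, w) \<in> ?O \<times> ?O. \<not> Q (mix A v w)} = card {v \<in> ?O. \<not> Q v} * card ?O" for A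
  proof -
    let ?f = "\<lambda>(v, w). (mix A v w, mix A w v)"
    have inv: "?f (?f p) = p" for p :: "(nat \<Rightarrow> _) \<times> (nat \<Rightarrow> _)" by (cases p) (auto simp: mix_def fun_eq_iff)
    have "bij_betw ?f {(v, w) \<in> ?O \<times> ?O. \<not> Q (mix A v w)} ({v \<in> ?O. \<not> Q v} \<times> ?O)"
    proof (rule bij_betwI[where g = ?f])
      show "?f \<in> {(v, w) \<in> ?O \<times> ?O. \<not> Q (mix A v w)} \<rightarrow> {v \<in> ?O. \<not> Q v} \<times> ?O"
        by (auto intro!: mix_in_PiE)
      show "?f \<in> {v \<in> ?O. \<not> Q v} \<times> ?O \<rightarrow> {(v, w) \<in> ?O \<times> ?O. \<not> Q (mix A v w)}"
      proof
        fix p assume p: "p \<in> {v \<in> ?O. \<not> Q v} \<times> ?O"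
        obtain v w where vw: "p = (v, w)" by (cases p)
        have "mix A (mix A v w) (mix A w v) = v" by (auto simp: mix_def fun_eq_iff)
        then show "?f p \<in> {(v, w) \<in> ?O \<times> ?O. \<not> Q (mix A v w)}"
          using p vw by (auto intro!: mix_in_PiE)
      qed
    qed (rule inv)+
    then show ?thesis by (simp add: bij_betw_same_card card_cartesian_product)
  qed
  have "(\<Sum>v\<in>?O. real (card {w \<in> ?O. \<exists>A\<subseteq>I. \<not> Q (mix A v w)}))
     = real (card (Sigma ?O (\<lambda>v. {w \<in> ?O. \<exists>A\<subseteq>I. \<not> Q (mix A v w)})))"
    using assms(2) by simp
  also have "Sigma ?O (\<lambda>v. {w \<in> ?O. \<exists>A\<subseteq>I. \<not> Q (mix A v w)})
     = (\<Union>A\<in>Pow I. {(v, w) \<in> ?O \<times> ?O. \<not> Q (mix A v w)})" by auto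
  also have "real (card \<dots>) \<le> real (\<Sum>A\<in>Pow I. card {(v, w) \<in> ?O \<times> ?O. \<not> Q (mix A v w)})"
    using assms(1) by (intro of_nat_mono card_UN_le) simp
  also have "\<dots> = 2 ^ card I * (real (card {v \<in> ?O. \<not> Q v}) * real (card ?O))"
    by (simp only: one) (simp add: card_Pow assms(1))
  also have "\<dots> \<le> 2 ^ card I * (\<beta> * real (card ?O) * real (card ?O))"
    by (intro mult_left_mono mult_right_mono assms(4)) auto
  also have "\<dots> = (\<Sum>v\<in>?O. 2 ^ card I * \<beta> * real (card ?O))" by simp
  also have "\<dots> < (\<Sum>v\<in>?O. real (card {w \<in> ?O. \<exists>A\<subseteq>I. \<not> Q (mix A v w)}))"
    using assms big by (intro sum_strict_mono) auto
  finally show False by simp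
qed

subsection \<open>Labels from a reference transversal\<close>

text \<open>Lets the number of colours be compared between two colourings that agree only up to
  renaming.\<close>

lemma card_image_same_kernel:
  assumes "\<And>x y. x \<in> A \<Longrightarrow> y \<in> A \<Longrightarrow> f x = f y \<longleftrightarrow> g x = g y"
  shows "card (f ` A) = card (g ` A)"
proof (rule bij_betw_same_card)
  have "g (inv_into A f (f x)) = g x" if "x \<in> A" for x
    using assms[of "inv_into A f (f x)" x] that by (simp add: f_inv_into_f inv_into_into)
  moreover have "f (inv_into A g (g x)) = f x" if "x \<in> A" for x
    using assms[of "inv_into A g (g x)" x] that by (simp add: f_inv_into_f inv_into_into)
  ultimately show "bij_betw (\<lambda>z. g (inv_into A f z)) (f ` A) (g ` A)"
    by (intro bij_betwI[where g = "\<lambda>z. f (inv_into A g z)"]) auto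
qed

lemma balanced_colouring_onto:
  assumes "balanced_colouring r k c" "0 < r" "r \<le> k"
  shows "c ` {1..k} = {1..r}"
proof
  show "c ` {1..k} \<subseteq> {1..r}" using assms(1) by (simp add: balanced_colouring_def)
  show "{1..r} \<subseteq> c ` {1..k}"
  proof
    fix i assume "i \<in> {1..r}"
    then have "card {j \<in> {1..k}. c j = i} \<in> {k div r, k div r + 1}"
      using assms(1) by (simp add: balanced_colouring_def)
    moreover have "0 < k div r" using assms by (simp add: div_greater_zero_iff)
    ultimately have "{j \<in> {1..k}. c j = i} \<noteq> {}" by (metis card.empty empty_iff insert_iff less_numeral_extra(3) nat_neq_iff zero_less_Suc add_gr_0)
    then show "i \<in> c ` {1..k}" by auto
  qed
qed

text \<open>The graph fixes the colour classes, so d has as many colours as a balanced colouring c,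
  namely r. Hence d is onto {1..r} and each of its classes is a class of c under another
  name.\<close>

lemma turan_colouring_balanced:
  assumes "is_turan r k H" "0 < r" "r \<le> k" "d ` {1..k} \<subseteq> {1..r}"
    and "\<And>i j. i \<in> {1..k} \<Longrightarrow> j \<in> {1..k} \<Longrightarrow> H i j \<longleftrightarrow> d i \<noteq> d j"
  shows "balanced_colouring r k d"
proof -
  obtain c where c: "balanced_colouring r k c" "\<forall>i\<in>{1..k}. \<forall>j\<in>{1..k}. H i j \<longleftrightarrow> c i \<noteq> c j"
    using assms(1) by (auto simp: is_turan_def)
  have ker: "d i = d j \<longleftrightarrow> c i = c j" if "i \<in> {1..k}" "j \<in> {1..k}" for i j
    using assms(5)[OF that] c(2) that by blast
  have conto: "c ` {1..k} = {1..r}" by (rule balanced_colouring_onto[OF c(1) assms(2,3)])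
  have "card (d ` {1..k}) = card (c ` {1..k})" by (rule card_image_same_kernel) (rule ker)
  then have donto: "d ` {1..k} = {1..r}" using conto assms(4) by (intro card_subset_eq) auto
  have "card {j \<in> {1..k}. d j = i} \<in> {k div r, k div r + 1}" if "i \<in> {1..r}" for i
  proof -
    have "i \<in> d ` {1..k}" using donto that by simp
    then obtain l where l: "l \<in> {1..k}" "d l = i" by auto
    have "{j \<in> {1..k}. d j = i} = {j \<in> {1..k}. c j = c l}"
      unfolding l(2)[symmetric]
    proof (rule Collect_cong, rule conj_cong[OF refl])
      fix j assume "j \<in> {1..k}"
      then show "d j = d l \<longleftrightarrow> c j = c l" using l(1) by (rule ker)
    qed
    moreover have "c l \<in> {1..r}" using conto l by blast
    ultimately show ?thesis using c(1) by (simp add: balanced_colouring_def)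
  qed
  then show ?thesis using assms(4) by (simp add: balanced_colouring_def)
qed

lemma is_turan_cong:
  assumes "is_turan r k H" "\<And>i j. i \<in> {1..k} \<Longrightarrow> j \<in> {1..k} \<Longrightarrow> H i j = H' i j"
  shows "is_turan r k H'"
  using assms unfolding is_turan_def by auto

text \<open>The label of a replacement x for the vertex v j is the colour class that x avoids. If j is
  alone in its class, x may be adjacent to all the others, and the label is the missing colour.\<close>

lemma turan_replace_one:
  assumes "0 < r" "r \<le> k" "balanced_colouring r k c"
    and c: "\<And>i j. i \<in> {1..k} \<Longrightarrow> j \<in> {1..k} \<Longrightarrow> R (v i) (v j) \<longleftrightarrow> c i \<noteq> c j"
    and "symp R" "j \<in> {1..k}" and T: "is_turan r k (\<lambda>a b. R ((v(j := x)) a) ((v(j := x)) b))"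
  shows "\<exists>i\<in>{1..r}. \<forall>l\<in>{1..k} - {j}. R x (v l) \<longleftrightarrow> c l \<noteq> i"
proof -
  obtain d where d: "balanced_colouring r k d"
    "\<And>a b. a \<in> {1..k} \<Longrightarrow> b \<in> {1..k} \<Longrightarrow> R ((v(j := x)) a) ((v(j := x)) b) \<longleftrightarrow> d a \<noteq> d b"
    using T unfolding is_turan_def by blast
  define L where "L = {1..k} - {j}"
  have LL: "c a = c b \<longleftrightarrow> d a = d b" if "a \<in> L" "b \<in> L" for a b
    using c[of a b] d(2)[of a b] that by (auto simp: L_def)
  have xL: "R x (v l) \<longleftrightarrow> d j \<noteq> d l" if "l \<in> L" for l
    using d(2)[of j l] that assms(6) by (auto simp: L_def)
  show ?thesis
  proof (cases "\<exists>m\<in>L. d m = d j")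
    case True
    then obtain m where m: "m \<in> L" "d m = d j" by blast
    have "R x (v l) \<longleftrightarrow> c l \<noteq> c m" if "l \<in> L" for l using xL[OF that] LL[OF that m(1)] m(2) by auto
    moreover have "c m \<in> {1..r}"
      using balanced_colouring_onto[OF assms(3,1,2)] m(1) unfolding L_def by blast
    ultimately show ?thesis unfolding L_def by blast
  next
    case False
    have k: "{1..k} = insert j L" using assms(6) by (auto simp: L_def)
    \<comment> \<open>If x is alone in its class, the remaining vertices use only r - 1 colours of
      d; on them c has the same classes, so c also leaves a colour free.\<close>
    have "card (insert (d j) (d ` L)) = r"
      using balanced_colouring_onto[OF d(1) assms(1,2)] unfolding k by simp
    moreover have "d j \<notin> d ` L" using False by force
    ultimately have "card (d ` L) < r" by (simp add: L_def)
    moreover have "card (c ` L) = card (d ` L)" by (rule card_image_same_kernel) (rule LL)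
    ultimately have lt: "card (c ` L) < card {1..r}" by simp
    have "\<not> {1..r} \<subseteq> c ` L"
    proof
      assume "{1..r} \<subseteq> c ` L"
      then have "card {1..r} \<le> card (c ` L)" by (rule card_mono[rotated]) (simp add: L_def)
      then show False using lt by simp
    qed
    then obtain i where "i \<in> {1..r}" "i \<notin> c ` L" by blast
    then show ?thesis using xL False unfolding L_def by (intro bexI[of _ i]) force+
  qed
qed

text \<open>If an unreplaced vertex carries the label of x or of y, it is a twin of that replacement
  in the new graph, and the adjacency in question is read off from it. Otherwise both labels are
  absent from the unreplaced vertices, and the number of colours that the new colouring d still has
  to supply, one or two, decides. The single-replacement hypotheses tie that number to the
  labels.\<close>

lemma turan_replace_two:
  assumes "0 < r" "r \<le> k" "balanced_colouring r k c"
    and c: "\<And>i j. i \<in> {1..k} \<Longrightarrow> j \<in> {1..k} \<Longrightarrow> R (v i) (v j) \<longleftrightarrow> c i \<noteq> c j"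
    and j: "j \<in> {1..k}" "j' \<in> {1..k}" "j \<noteq> j'"
    and T: "is_turan r k (\<lambda>a b. R ((v(j := x, j' := y)) a) ((v(j := x, j' := y)) b))"
    and bal: "balanced_colouring r k (c(j := i))" "balanced_colouring r k (c(j' := i'))"
    and i: "\<And>l. l \<in> {1..k} - {j} \<Longrightarrow> R x (v l) \<longleftrightarrow> c l \<noteq> i"
    and i': "\<And>l. l \<in> {1..k} - {j'} \<Longrightarrow> R y (v l) \<longleftrightarrow> c l \<noteq> i'"
  shows "R x y \<longleftrightarrow> i \<noteq> i'"
proof -
  obtain d where d: "balanced_colouring r k d"
    "\<And>a b. a \<in> {1..k} \<Longrightarrow> b \<in> {1..k} \<Longrightarrow>
       R ((v(j := x, j' := y)) a) ((v(j := x, j' := y)) b) \<longleftrightarrow> d a \<noteq> d b"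
    using T unfolding is_turan_def by blast
  define L where "L = {1..k} - {j, j'}"
  have LL: "c a = c b \<longleftrightarrow> d a = d b" if "a \<in> L" "b \<in> L" for a b
    using c[of a b] d(2)[of a b] that by (auto simp: L_def)
  have xL: "c l = i \<longleftrightarrow> d j = d l" if "l \<in> L" for l
    using d(2)[of j l] i[of l] that j by (auto simp: L_def)
  have yL: "c l = i' \<longleftrightarrow> d j' = d l" if "l \<in> L" for l
    using d(2)[of j' l] i'[of l] that j by (auto simp: L_def)
  have xy: "R x y \<longleftrightarrow> d j \<noteq> d j'" using d(2)[of j j'] j by auto
  consider l where "l \<in> L" "c l = i" | l where "l \<in> L" "c l = i'"
    | "i \<notin> c ` L" "i' \<notin> c ` L" by blast
  then show ?thesis
  proof cases
    case 1
    then have "d j = d l" using xL by blast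
    then show ?thesis using yL[OF 1(1)] 1(2) unfolding xy by metis
  next
    case 2
    then have "d j' = d l" using yL by blast
    then show ?thesis using xL[OF 2(1)] 2(2) unfolding xy by metis
  next
    \<comment> \<open>Both replacements need new colours: \<open>rd\<close> says that d has one
      colour left on L if they are nonadjacent and two otherwise, and by \<open>cd\<close> the same
      number of colours of c is missing on L.\<close>
    case 3
    have fin: "finite (c ` L)" "finite (d ` L)" by (simp_all add: L_def)
    have k: "{1..k} = insert j (insert j' L)" using j by (auto simp: L_def)
    have jL: "j \<notin> L" "j' \<notin> L" by (auto simp: L_def)
    have onto: "f ` {1..k} = insert (f j) (insert (f j') (f ` L))" for f :: "nat \<Rightarrow> nat"
      unfolding k by simp
    have dj: "d j \<notin> d ` L" using xL 3(1) by force
    have dj': "d j' \<notin> d ` L" using yL 3(2) by force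
    have cd: "card (c ` L) = card (d ` L)" by (rule card_image_same_kernel) (rule LL)
    have D: "insert (d j) (insert (d j') (d ` L)) = {1..r}"
      using balanced_colouring_onto[OF d(1) assms(1,2)] onto by metis
    then have "card (insert (d j) (insert (d j') (d ` L))) = r" by simp
    then have rd: "card (d ` L) + (if d j = d j' then 1 else 2) = r"
      using dj dj' fin by (auto simp: card_insert_if)
    have upd: "(c(j := i)) ` L = c ` L" "(c(j' := i')) ` L = c ` L" using jL by auto
    have C: "insert (c j) (insert (c j') (c ` L)) = {1..r}"
      using balanced_colouring_onto[OF assms(3) assms(1,2)] onto by metis
    have C1: "insert i (insert (c j') (c ` L)) = {1..r}"
      using balanced_colouring_onto[OF bal(1) assms(1,2)] onto[of "c(j := i)"] upd j(3) by simp
    have C2: "insert (c j) (insert i' (c ` L)) = {1..r}"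
      using balanced_colouring_onto[OF bal(2) assms(1,2)] onto[of "c(j' := i')"] upd j(3) by simp
    show ?thesis
    proof (cases "i = i'")
      case True
      \<comment> \<open>The common label is one of the two removed colours. Replacing just the
        vertex that did not have this colour must still use all r colours, so no second colour can
        be missing on L.\<close>
      have "i \<in> {1..r}" using C1 by blast
      then have "i = c j \<or> i = c j'" using C 3(1) by blast
      then have "insert i (c ` L) = {1..r}" using C1 C2 True by auto
      then have "card (insert i (c ` L)) = r" by simp
      then have "card (c ` L) + 1 = r" using 3(1) fin by simp
      then show ?thesis using rd cd True unfolding xy by (auto split: if_splits)
    next
      case False
      have "insert i (insert i' (c ` L)) \<subseteq> {1..r}" using C1 C2 by blast
      then have "card (insert i (insert i' (c ` L))) \<le> card {1..r}" by (rule card_mono[rotated]) simp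
      then have "card (c ` L) + 2 \<le> r" using 3 fin False by simp
      then show ?thesis using rd cd False unfolding xy by (auto split: if_splits)
    qed
  qed
qed

text \<open>The label of x at place j is defined from its adjacencies to v alone, so it does not
  depend on the transversal w through x. For each w only the mixtures equal to v or w, or to v with
  one or two places replaced, are needed.\<close>

lemma exists_labelling:
  fixes R :: "'v \<Rightarrow> 'v \<Rightarrow> bool"
  assumes r: "0 < r" "r \<le> k" and "symp R"
    and mix: "\<And>w A. w \<in> W \<Longrightarrow> A \<subseteq> {1..k} \<Longrightarrow> is_turan r k (\<lambda>a b. R (mix A v w a) (mix A v w b))"
  shows "\<exists>lab. (\<forall>j x. lab j x \<in> {1..r}) \<and> (\<forall>w\<in>W. balanced_colouring r k (\<lambda>j. lab j (w j)) \<and>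
     (\<forall>i\<in>{1..k}. \<forall>j\<in>{1..k}. R (w i) (w j) \<longleftrightarrow> lab i (w i) \<noteq> lab j (w j)))"
proof (cases "W = {}")
  case True
  then show ?thesis using r by (intro exI[of _ "\<lambda>_ _. 1"]) auto
next
  case False
  then obtain w0 where "w0 \<in> W" by blast
  from mix[OF this, of "{1..k}"] have "is_turan r k (\<lambda>a b. R (v a) (v b))"
    by (rule is_turan_cong) (auto simp: mix_def)
  then obtain c where cb: "balanced_colouring r k c"
    and c: "\<And>i j. i \<in> {1..k} \<Longrightarrow> j \<in> {1..k} \<Longrightarrow> R (v i) (v j) \<longleftrightarrow> c i \<noteq> c j"
    unfolding is_turan_def by blast
  have sym: "R x y = R y x" for x y using sympD[OF assms(3)] by blast
  \<comment> \<open>The adjacency pattern of x to v without its j-th member is that of a vertex of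
    colour i.\<close>
  define Lab where "Lab j x i \<longleftrightarrow> i \<in> {1..r} \<and> (\<forall>l\<in>{1..k} - {j}. R x (v l) \<longleftrightarrow> c l \<noteq> i)" for j x i
  \<comment> \<open>The default 1 keeps the range in {1..r} for vertices whose pattern towards v
    fits no colour; \<open>lab1\<close> shows that vertices of good transversals do have a fitting
    one.\<close>
  define lab where "lab j x = (if \<exists>i. Lab j x i then SOME i. Lab j x i else 1)" for j x
  have labI: "Lab j x (lab j x)" if "Lab j x i" for j x i
    unfolding lab_def using that someI[of "Lab j x"] by auto
  have range: "lab j x \<in> {1..r}" for j x
  proof (cases "\<exists>i. Lab j x i")
    case True
    then show ?thesis using labI unfolding Lab_def by blast
  next
    case False
    then show ?thesis using r by (simp add: lab_def)
  qed
  have good: "balanced_colouring r k (\<lambda>j. lab j (w j)) \<and>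
     (\<forall>i\<in>{1..k}. \<forall>j\<in>{1..k}. R (w i) (w j) \<longleftrightarrow> lab i (w i) \<noteq> lab j (w j))" if w: "w \<in> W" for w
  proof -
    have turan_w: "is_turan r k (\<lambda>a b. R (w a) (w b))"
      using mix[OF w, of "{}"] by (simp add: mix_def)
    have irr: "\<not> R (w i) (w i)" if "i \<in> {1..k}" for i
      using turan_w that by (auto simp: is_turan_def)
    have one: "is_turan r k (\<lambda>a b. R ((v(j := w j)) a) ((v(j := w j)) b))" if "j \<in> {1..k}" for j
      by (rule is_turan_cong[OF mix[OF w, of "{1..k} - {j}"]]) (auto simp: mix_def)
    have lab1: "Lab j (w j) (lab j (w j))" if j: "j \<in> {1..k}" for j
      using turan_replace_one[OF r cb c assms(3) j one[OF j]] labI unfolding Lab_def by blast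
    \<comment> \<open>Recolouring one place gives a proper colouring of a Turan graph, hence a
      balanced one; this is the input needed for replacing two places.\<close>
    have bal: "balanced_colouring r k (c(j := lab j (w j)))" if j: "j \<in> {1..k}" for j
    proof (rule turan_colouring_balanced[OF one[OF j] r])
      show "(c(j := lab j (w j))) ` {1..k} \<subseteq> {1..r}"
        using cb range[of j "w j"] by (auto simp: balanced_colouring_def)
      fix a b assume ab: "a \<in> {1..k}" "b \<in> {1..k}"
      have L: "R (w j) (v l) \<longleftrightarrow> c l \<noteq> lab j (w j)" if "l \<in> {1..k}" "l \<noteq> j" for l
        using lab1[OF j] that unfolding Lab_def by blast
      show "R ((v(j := w j)) a) ((v(j := w j)) b) \<longleftrightarrow> (c(j := lab j (w j))) a \<noteq> (c(j := lab j (w j))) b"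
      proof (cases "a = j"; cases "b = j")
        assume "a = j" "b = j"
        then show ?thesis using irr[OF j] by simp
      next
        assume "a = j" "b \<noteq> j"
        then show ?thesis using L[OF ab(2)] by auto
      next
        assume "a \<noteq> j" "b = j"
        then show ?thesis using L[OF ab(1)] sym[of "v a" "w j"] by auto
      next
        assume "a \<noteq> j" "b \<noteq> j"
        then show ?thesis using c[OF ab] by auto
      qed
    qed
    have pair: "R (w i) (w j) \<longleftrightarrow> lab i (w i) \<noteq> lab j (w j)" if ij: "i \<in> {1..k}" "j \<in> {1..k}" for i j
    proof (cases "i = j")
      case True
      then show ?thesis using irr ij by simp
    next
      case ne: False
      have T: "is_turan r k (\<lambda>a b. R ((v(i := w i, j := w j)) a) ((v(i := w i, j := w j)) b))"
        by (rule is_turan_cong[OF mix[OF w, of "{1..k} - {i, j}"]]) (auto simp: mix_def)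
      show ?thesis
      proof (rule turan_replace_two[where v = v and c = c and k = k and r = r and j = i and j' = j])
        show "is_turan r k (\<lambda>a b. R ((v(i := w i, j := w j)) a) ((v(i := w i, j := w j)) b))"
          by (rule T)
        show "balanced_colouring r k (c(i := lab i (w i)))" "balanced_colouring r k (c(j := lab j (w j)))"
          using bal ij by blast+
        show "\<And>l. l \<in> {1..k} - {i} \<Longrightarrow> R (w i) (v l) \<longleftrightarrow> c l \<noteq> lab i (w i)"
          using lab1[OF ij(1)] by (simp add: Lab_def)
        show "\<And>l. l \<in> {1..k} - {j} \<Longrightarrow> R (w j) (v l) \<longleftrightarrow> c l \<noteq> lab j (w j)"
          using lab1[OF ij(2)] by (simp add: Lab_def)
      qed (use r cb c ij ne in auto)
    qed
    have "balanced_colouring r k (\<lambda>j. lab j (w j))"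
      by (rule turan_colouring_balanced[OF turan_w r]) (use range pair in auto)
    then show ?thesis using pair by blast
  qed
  show ?thesis using range good by blast
qed

text \<open>A selection that avoids the label i whenever possible shows that i is forced on at least a
  classes; one that takes i whenever possible shows that i occurs on at most a + 1 of them.\<close>

lemma balanced_selections_structure:
  fixes S :: "nat \<Rightarrow> nat set" and r k :: nat
  defines "a \<equiv> k div r"
  assumes "0 < r" "r \<le> k"
    and S: "\<And>j. j \<in> {1..k} \<Longrightarrow> S j \<noteq> {} \<and> S j \<subseteq> {1..r}"
    and bal: "\<And>s. (\<And>j. j \<in> {1..k} \<Longrightarrow> s j \<in> S j) \<Longrightarrow> balanced_colouring r k s"
  shows "\<exists>\<sigma>. \<sigma> permutes {1..k} \<and>
     (\<forall>i\<in>{1..r}. \<forall>m\<in>{(i - 1) * a + 1..i * a}. S (\<sigma> m) = {i}) \<and>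
     (\<forall>i\<in>{1..r}. \<forall>m\<in>{a * r + 1..k}. \<forall>m'\<in>{a * r + 1..k}.
        i \<in> S (\<sigma> m) \<longrightarrow> i \<in> S (\<sigma> m') \<longrightarrow> m = m')"
proof -
  have a0: "0 < a" using assms(2,3) by (simp add: a_def div_greater_zero_iff)
  have ark: "a * r \<le> k" by (simp add: a_def)
  have iak: "i * a \<le> k" if "i \<in> {1..r}" for i
  proof -
    have "i * a \<le> r * a" using that by (intro mult_le_mono1) simp
    also have "\<dots> \<le> k" using ark by (simp only: mult.commute)
    finally show ?thesis .
  qed
  have pure: "a \<le> card {j \<in> {1..k}. S j = {i}}" if i: "i \<in> {1..r}" for i
  proof -
    define s where "s j = (if S j = {i} then i else SOME x. x \<in> S j - {i})" for j
    have s: "s j \<in> S j \<and> (s j = i \<longleftrightarrow> S j = {i})" if "j \<in> {1..k}" for j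
    proof (cases "S j = {i}")
      case False
      then have "\<exists>x. x \<in> S j - {i}" using S[OF that] by blast
      then have "(SOME x. x \<in> S j - {i}) \<in> S j - {i}" by (rule someI_ex)
      then show ?thesis using False by (simp add: s_def)
    qed (simp add: s_def)
    then have "balanced_colouring r k s" using bal by blast
    then have "card {j \<in> {1..k}. s j = i} \<in> {a, a + 1}"
      using i unfolding balanced_colouring_def a_def by blast
    then have "a \<le> card {j \<in> {1..k}. s j = i}" by auto
    moreover have "{j \<in> {1..k}. s j = i} = {j \<in> {1..k}. S j = {i}}" using s by blast
    ultimately show ?thesis by simp
  qed
  have touched: "card {j \<in> {1..k}. i \<in> S j} \<le> a + 1" if i: "i \<in> {1..r}" for i
  proof -
    define s where "s j = (if i \<in> S j then i else SOME x. x \<in> S j)" for j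
    have s: "s j \<in> S j \<and> (s j = i \<longleftrightarrow> i \<in> S j)" if "j \<in> {1..k}" for j
    proof (cases "i \<in> S j")
      case False
      have "\<exists>x. x \<in> S j" using S[OF that] by blast
      then have "(SOME x. x \<in> S j) \<in> S j" by (rule someI_ex)
      then show ?thesis using False by (auto simp: s_def)
    qed (simp add: s_def)
    then have "balanced_colouring r k s" using bal by blast
    then have "card {j \<in> {1..k}. s j = i} \<in> {a, a + 1}"
      using i unfolding balanced_colouring_def a_def by blast
    then have "card {j \<in> {1..k}. s j = i} \<le> a + 1" by auto
    moreover have "{j \<in> {1..k}. s j = i} = {j \<in> {1..k}. i \<in> S j}" using s by blast
    ultimately show ?thesis by simp
  qed
  \<comment> \<open>Exactly a of the classes forced to have label i are selected for the i-th block;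
    any further ones go to the leftover.\<close>
  have "\<exists>Q. Q \<subseteq> {j \<in> {1..k}. S j = {i}} \<and> card Q = a" if "i \<in> {1..r}" for i
    using obtain_subset_with_card_n[OF pure[OF that]] by metis
  then obtain Q where Q: "\<And>i. i \<in> {1..r} \<Longrightarrow> Q i \<subseteq> {j \<in> {1..k}. S j = {i}} \<and> card (Q i) = a"
    by metis
  \<comment> \<open>Here q assigns to each class the block it should go to, and p assigns to each
    position the block it lies in; r + 1 stands for the leftover. The shift in p comes from
    numbering positions and blocks from 1.\<close>
  define q where "q j = (if \<exists>i\<in>{1..r}. j \<in> Q i then the_elem (S j) else r + 1)" for j
  define p where "p m = (if m \<le> a * r then (m - 1) div a + 1 else r + 1)" for m
  have qi: "q j = i \<longleftrightarrow> j \<in> Q i" if i: "i \<in> {1..r}" for i j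
  proof
    assume "j \<in> Q i"
    then show "q j = i" using Q[OF i] i by (auto simp: q_def)
  next
    assume "q j = i"
    then obtain i' where i': "i' \<in> {1..r}" "j \<in> Q i'" using i by (auto simp: q_def split: if_splits)
    then have "q j = i'" using Q[OF i'(1)] by (auto simp: q_def)
    then show "j \<in> Q i" using i' \<open>q j = i\<close> by simp
  qed
  have qr: "q j = r + 1 \<longleftrightarrow> (\<forall>i\<in>{1..r}. j \<notin> Q i)" for j
  proof
    assume "q j = r + 1"
    show "\<forall>i\<in>{1..r}. j \<notin> Q i"
    proof (intro ballI notI)
      fix i assume i: "i \<in> {1..r}" "j \<in> Q i"
      then have "q j = i" using qi by blast
      then show False using \<open>q j = r + 1\<close> i(1) by simp
    qed
  next
    assume "\<forall>i\<in>{1..r}. j \<notin> Q i"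
    then have "\<not> (\<exists>i\<in>{1..r}. j \<in> Q i)" by blast
    then show "q j = r + 1" unfolding q_def by (rule if_not_P)
  qed
  have qrange: "q j \<in> {1..r + 1}" for j
  proof (cases "\<forall>i\<in>{1..r}. j \<notin> Q i")
    case True
    then have "q j = r + 1" using qr by blast
    then show ?thesis by simp
  next
    case False
    then obtain i where "i \<in> {1..r}" "q j = i" using qi by blast
    then show ?thesis by simp
  qed
  have pi: "p m = i \<longleftrightarrow> m \<in> {(i - 1) * a + 1..i * a}" if i: "i \<in> {1..r}" and m: "m \<in> {1..k}" for i m
  proof -
    obtain m' where m': "m = Suc m'" using m by (cases m) auto
    obtain i' where i': "i = Suc i'" using i by (cases i) auto
    have "m' div a = i' \<longleftrightarrow> i' \<le> m' div a \<and> m' div a < Suc i'" by auto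
    also have "\<dots> \<longleftrightarrow> i' * a \<le> m' \<and> m' < Suc i' * a"
      by (simp only: less_eq_div_iff_mult_less_eq[OF a0] div_less_iff_less_mult[OF a0])
    finally have div_eq: "m' div a = i' \<longleftrightarrow> i' * a \<le> m' \<and> m' < Suc i' * a" .
    have "p m = i \<longleftrightarrow> m \<le> a * r \<and> m' div a = i'" using i by (auto simp: p_def m' i')
    also have "\<dots> \<longleftrightarrow> m \<le> a * r \<and> (i' * a \<le> m' \<and> m' < i * a)" by (simp only: div_eq i')
    also have "\<dots> \<longleftrightarrow> m \<in> {(i - 1) * a + 1..i * a}"
    proof -
      have "i * a \<le> a * r" using i by (simp add: mult.commute)
      then show ?thesis unfolding m' i' by (simp only: atLeastAtMost_iff diff_Suc_1) linarith
    qed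
    finally show ?thesis .
  qed
  have div_less: "(m - 1) div a < r" if "m \<in> {1..k}" "m \<le> a * r" for m
  proof -
    have "1 \<le> m" using that(1) by simp
    then have "m - 1 < r * a" using that(2) by (simp only: mult.commute[of r a])
    then show ?thesis by (rule less_mult_imp_div_less)
  qed
  have pr: "p m = r + 1 \<longleftrightarrow> a * r < m" if "m \<in> {1..k}" for m
    using div_less[OF that] by (auto simp: p_def)
  have prange: "p m \<in> {1..r + 1}" if "m \<in> {1..k}" for m
    using div_less[OF that] by (auto simp: p_def)
  \<comment> \<open>Equal fibre sizes suffice for a permutation carrying positions to classes of the
    same block, so \<sigma> need not be constructed by hand.\<close>
  have "image_mset p (mset_set {1..k}) = image_mset q (mset_set {1..k})"
  proof (rule multiset_eqI)
    fix i
    have "card {m \<in> {1..k}. p m = i} = card {j \<in> {1..k}. q j = i}"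
    proof -
      consider "i \<in> {1..r}" | "i = r + 1" | "i \<notin> {1..r + 1}" by fastforce
      then show ?thesis
      proof cases
        case 1
        then have "i * a \<le> k" by (rule iak)
        then have "{(i - 1) * a + 1..i * a} \<subseteq> {1..k}" by auto
        then have "{m \<in> {1..k}. p m = i} = {(i - 1) * a + 1..i * a}" using pi[OF 1] by blast
        moreover have "{j \<in> {1..k}. q j = i} = Q i" using qi[OF 1] Q[OF 1] by blast
        moreover have "i * a - (i - 1) * a = a" using 1 by (cases i) auto
        ultimately show ?thesis using Q[OF 1] by simp
      next
        case 2
        have "{m \<in> {1..k}. p m = i} = {m \<in> {1..k}. a * r < m}" using pr 2 by blast
        also have "\<dots> = {a * r + 1..k}" by auto
        finally have "{m \<in> {1..k}. p m = i} = {a * r + 1..k}" .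
        moreover have "{j \<in> {1..k}. q j = i} = {1..k} - (\<Union>i\<in>{1..r}. Q i)"
        proof (intro equalityI subsetI)
          fix j assume "j \<in> {j \<in> {1..k}. q j = i}"
          then have "j \<in> {1..k}" "q j = r + 1" using 2 by auto
          then show "j \<in> {1..k} - (\<Union>i\<in>{1..r}. Q i)" using qr[of j] by blast
        next
          fix j assume "j \<in> {1..k} - (\<Union>i\<in>{1..r}. Q i)"
          then have "j \<in> {1..k}" "q j = r + 1" using qr[of j] by blast+
          then show "j \<in> {j \<in> {1..k}. q j = i}" using 2 by simp
        qed
        moreover have "card ({1..k} - (\<Union>i\<in>{1..r}. Q i)) = k - r * a"
        proof -
          have Qk: "Q i \<subseteq> {1..k}" if "i \<in> {1..r}" for i using Q[OF that] by blast
          then have QU: "(\<Union>i\<in>{1..r}. Q i) \<subseteq> {1..k}" by (rule UN_least)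
          have "card (\<Union>i\<in>{1..r}. Q i) = (\<Sum>i\<in>{1..r}. card (Q i))"
          proof (rule card_UN_disjoint)
            show "\<forall>i\<in>{1..r}. finite (Q i)" using Qk finite_subset[OF _ finite_atLeastAtMost] by blast
            show "\<forall>i\<in>{1..r}. \<forall>j\<in>{1..r}. i \<noteq> j \<longrightarrow> Q i \<inter> Q j = {}"
            proof (intro ballI impI)
              fix i j assume ij: "i \<in> {1..r}" "j \<in> {1..r}" "i \<noteq> j"
              show "Q i \<inter> Q j = {}" using qi[OF ij(1)] qi[OF ij(2)] ij(3) by fastforce
            qed
          qed simp
          then have "card (\<Union>i\<in>{1..r}. Q i) = r * a" using Q by simp
          moreover have "finite (\<Union>i\<in>{1..r}. Q i)" by (rule finite_subset[OF QU]) simp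
          ultimately show ?thesis using QU by (simp add: card_Diff_subset)
        qed
        ultimately show ?thesis by (simp add: mult.commute)
      next
        case 3
        then have "{m \<in> {1..k}. p m = i} = {}" "{j \<in> {1..k}. q j = i} = {}"
          using prange qrange by blast+
        then show ?thesis by (simp only: card.empty)
      qed
    qed
    then show "count (image_mset p (mset_set {1..k})) i = count (image_mset q (mset_set {1..k})) i"
      by (simp add: count_image_mset_eq_card_vimage)
  qed
  then obtain \<sigma> where \<sigma>: "\<sigma> permutes {1..k}" "\<forall>x\<in>{1..k}. p x = q (\<sigma> x)"
    using image_mset_eq_implies_permutes[of "{1..k}" p q] by auto
  have in1: "\<sigma> m \<in> {1..k}" if "m \<in> {1..k}" for m using permutes_in_image[OF \<sigma>(1)] that by blast
  show ?thesis
  proof (intro exI[of _ \<sigma>] conjI ballI impI \<sigma>(1))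
    fix i m assume i: "i \<in> {1..r}" and m: "m \<in> {(i - 1) * a + 1..i * a}"
    have mk: "m \<in> {1..k}" using m iak[OF i] by auto
    then have "p m = i" using pi[OF i mk] m by simp
    then have "\<sigma> m \<in> Q i" using \<sigma>(2) mk qi[OF i] by simp
    then show "S (\<sigma> m) = {i}" using Q[OF i] by blast
  next
    fix i m m' assume i: "i \<in> {1..r}" and m: "m \<in> {a * r + 1..k}" "m' \<in> {a * r + 1..k}"
      and iS: "i \<in> S (\<sigma> m)" "i \<in> S (\<sigma> m')"
    have mk: "m \<in> {1..k}" "m' \<in> {1..k}" using m by auto
    then have "q (\<sigma> m) = r + 1" "q (\<sigma> m') = r + 1" using pr m \<sigma>(2) by auto
    then have "\<sigma> m \<notin> Q i" "\<sigma> m' \<notin> Q i" using qr i by blast+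
    \<comment> \<open>At most a + 1 classes allow label i and a of them are in \<open>Q i\<close>,
      so at most one leftover class allows it.\<close>
    then have sub: "{\<sigma> m, \<sigma> m'} \<subseteq> {j \<in> {1..k}. i \<in> S j} - Q i" using in1 mk iS by blast
    have Qi: "Q i \<subseteq> {j \<in> {1..k}. i \<in> S j}" using Q[OF i] by blast
    then have "finite (Q i)" by (rule finite_subset) simp
    then have "card ({j \<in> {1..k}. i \<in> S j} - Q i) \<le> 1"
      using Qi Q[OF i] touched[OF i] by (simp add: card_Diff_subset)
    moreover have "card {\<sigma> m, \<sigma> m'} \<le> card ({j \<in> {1..k}. i \<in> S j} - Q i)"
      by (rule card_mono[OF _ sub]) simp
    ultimately have "card {\<sigma> m, \<sigma> m'} \<le> 1" by simp
    then have "\<sigma> m = \<sigma> m'" by (cases "\<sigma> m = \<sigma> m'") auto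
    then show "m = m'" by (rule injD[OF permutes_inj[OF \<sigma>(1)]])
  qed
qed

subsection \<open>Transversals of multipartite graphs\<close>

lemma edge_complete_multipartite_iff:
  "{x, y} \<in> edges (complete_multipartite m U) \<longleftrightarrow>
     (\<exists>i\<in>{1..m}. \<exists>j\<in>{1..m}. i \<noteq> j \<and> x \<in> U i \<and> y \<in> U j)"
proof
  assume "{x, y} \<in> edges (complete_multipartite m U)"
  then obtain u v i j where *: "{x, y} = {u, v}" "i \<in> {1..m}" "j \<in> {1..m}" "i \<noteq> j" "u \<in> U i" "v \<in> U j"
    unfolding complete_multipartite_def by auto
  then have "x = u \<and> y = v \<or> x = v \<and> y = u" by (simp add: doubleton_eq_iff)
  then show "\<exists>i\<in>{1..m}. \<exists>j\<in>{1..m}. i \<noteq> j \<and> x \<in> U i \<and> y \<in> U j"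
    using *(2-6) by metis
next
  assume *: "\<exists>i\<in>{1..m}. \<exists>j\<in>{1..m}. i \<noteq> j \<and> x \<in> U i \<and> y \<in> U j"
  show "{x, y} \<in> edges (complete_multipartite m U)"
    unfolding complete_multipartite_def snd_conv mem_Collect_eq
    by (intro exI[of _ x] exI[of _ y] conjI refl *)
qed

lemma edge_of_classes:
  assumes "vertex_classes k n V" "E \<subseteq> edges (complete_multipartite k V)" "{x, y} \<in> E"
    and "i \<in> {1..k}" "j \<in> {1..k}" "x \<in> V i" "y \<in> V j"
  shows "i \<noteq> j"
proof
  assume "i = j"
  obtain i' j' where ij': "i' \<in> {1..k}" "j' \<in> {1..k}" "i' \<noteq> j'" "x \<in> V i'" "y \<in> V j'"
    using assms(2,3) edge_complete_multipartite_iff by (metis subsetD)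
  have "disjoint_family_on V {1..k}" using assms(1) by (simp add: vertex_classes_def)
  then have "i' = i" "j' = j" using ij' assms(4-7) unfolding disjoint_family_on_def by blast+
  then show False using ij' \<open>i = j\<close> by simp
qed

lemma card_multipartite_edges:
  assumes V: "vertex_classes k n V" and E: "E \<subseteq> edges (complete_multipartite k V)"
  shows "2 * card E = (\<Sum>i\<in>{1..k}. \<Sum>j\<in>{1..k}. card {(x, y) \<in> V i \<times> V j. {x, y} \<in> E})"
proof -
  let ?X = "\<Union>j\<in>{1..k}. V j"
  let ?S = "\<lambda>p. {(x, y) \<in> V (fst p) \<times> V (snd p). {x, y} \<in> E}"
  have fin: "\<And>j. j \<in> {1..k} \<Longrightarrow> finite (V j)" and disj: "disjoint_family_on V {1..k}"
    using V by (auto simp: vertex_classes_def)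
  have "2 * card E = card {(x, y) \<in> ?X \<times> ?X. {x, y} \<in> E}"
  proof (rule card_ordered_edges[symmetric])
    show "finite ?X" using fin by blast
    fix e assume e: "e \<in> E"
    then obtain u v where uv: "e = {u, v}" using E unfolding complete_multipartite_def by auto
    then obtain i j where ij: "i \<in> {1..k}" "j \<in> {1..k}" "i \<noteq> j" "u \<in> V i" "v \<in> V j"
      using e E edge_complete_multipartite_iff by (metis subsetD)
    then have "u \<noteq> v" using disj unfolding disjoint_family_on_def by blast
    then show "e \<subseteq> ?X \<and> card e = 2" using uv ij by auto
  qed
  also have "{(x, y) \<in> ?X \<times> ?X. {x, y} \<in> E} = (\<Union>p\<in>{1..k} \<times> {1..k}. ?S p)" by fastforce
  also have "card \<dots> = (\<Sum>p\<in>{1..k} \<times> {1..k}. card (?S p))"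
  proof (rule card_UN_disjoint)
    show "\<forall>p\<in>{1..k} \<times> {1..k}. finite (?S p)" using fin by (auto simp: finite_pairs)
    show "\<forall>p\<in>{1..k} \<times> {1..k}. \<forall>q\<in>{1..k} \<times> {1..k}. p \<noteq> q \<longrightarrow> ?S p \<inter> ?S q = {}"
      using disj unfolding disjoint_family_on_def by fastforce
  qed simp
  also have "\<dots> = (\<Sum>i\<in>{1..k}. \<Sum>j\<in>{1..k}. card {(x, y) \<in> V i \<times> V j. {x, y} \<in> E})"
    by (simp add: sum.cartesian_product split_def)
  finally show ?thesis .
qed

text \<open>The t vertices chosen in each class of K span the copy: any two of them from different
  classes of K lie on a common choice from the box, which makes them adjacent.\<close>

lemma contains_copy_from_box:
  fixes G :: "'v graph" and V T :: "nat \<Rightarrow> 'v set"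
  assumes disj: "disjoint_family_on V {1..k}" and G: "(\<Union>j\<in>{1..k}. V j) \<subseteq> verts G"
    and K: "K \<subseteq> {1..k}" "card K = r + 1" and t: "0 < t"
    and T: "\<And>j. j \<in> {1..k} \<Longrightarrow> T j \<subseteq> V j \<and> card (T j) = t"
    and box: "\<And>x. x \<in> PiE {1..k} T \<Longrightarrow> pairwise (\<lambda>i j. {x i, x j} \<in> edges G) K"
  shows "contains_copy G (balanced_complete_multipartite (r + 1) t)"
proof -
  have "finite K" by (rule finite_subset[OF K(1)]) simp
  then obtain g where g: "bij_betw g {1..r + 1} K"
    using ex_bij_betw_nat_finite_1 K(2) by metis
  have "\<exists>h. bij_betw h {1..t} (T j)" if "j \<in> {1..k}" for j
  proof -
    have "finite (T j)" using T[OF that] t by (intro card_ge_0_finite) simp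
    then show ?thesis using ex_bij_betw_nat_finite_1 T[OF that] by metis
  qed
  then obtain h where h: "\<And>j. j \<in> {1..k} \<Longrightarrow> bij_betw (h j) {1..t} (T j)" by metis
  have gK: "g i \<in> K" "g i \<in> {1..k}" if "i \<in> {1..r + 1}" for i
    using bij_betw_apply[OF g that] K(1) by blast+
  have hT: "h j s \<in> T j" if "j \<in> {1..k}" "s \<in> {1..t}" for j s
    by (rule bij_betw_apply[OF h[OF that(1)] that(2)])
  have hV: "h j s \<in> V j" if "j \<in> {1..k}" "s \<in> {1..t}" for j s
    using hT[OF that] T[OF that(1)] by blast
  have ginj: "i = i'" if "g i = g i'" "i \<in> {1..r + 1}" "i' \<in> {1..r + 1}" for i i'
    using inj_onD[OF bij_betw_imp_inj_on[OF g] that] .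
  let ?H = "balanced_complete_multipartite (r + 1) t"
  let ?f = "\<lambda>p. h (g (fst p)) (snd p)"
  have vH: "verts ?H = {1..r + 1} \<times> {1..t}"
    unfolding balanced_complete_multipartite_def complete_multipartite_def by auto
  show ?thesis
    unfolding contains_copy_def
  proof (intro exI[of _ ?f] conjI ballI)
    show "inj_on ?f (verts ?H)"
    proof (rule inj_onI)
      fix p q assume "p \<in> verts ?H" "q \<in> verts ?H" and eq: "?f p = ?f q"
      then have pq: "fst p \<in> {1..r + 1}" "snd p \<in> {1..t}" "fst q \<in> {1..r + 1}" "snd q \<in> {1..t}"
        unfolding vH by auto
      have "g (fst p) = g (fst q)"
      proof (rule ccontr)
        assume "g (fst p) \<noteq> g (fst q)"
        then have "V (g (fst p)) \<inter> V (g (fst q)) = {}"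
          using disj gK(2)[OF pq(1)] gK(2)[OF pq(3)] unfolding disjoint_family_on_def by blast
        then show False
          using hV[OF gK(2)[OF pq(1)] pq(2)] hV[OF gK(2)[OF pq(3)] pq(4)] eq by auto
      qed
      moreover from this have "snd p = snd q"
        using inj_onD[OF bij_betw_imp_inj_on[OF h[OF gK(2)[OF pq(1)]]] _ pq(2,4)] eq by simp
      ultimately show "p = q" using ginj pq by (simp add: prod_eq_iff)
    qed
    show "?f ` verts ?H \<subseteq> verts G"
    proof
      fix z assume "z \<in> ?f ` verts ?H"
      then obtain i s where "i \<in> {1..r + 1}" "s \<in> {1..t}" "z = h (g i) s" unfolding vH by auto
      then show "z \<in> verts G" using hV[OF gK(2)] gK(2) G by blast
    qed
    fix e assume "e \<in> edges ?H"
    then obtain i s i' s' where e: "e = {(i, s), (i', s')}" and i: "i \<in> {1..r + 1}" "i' \<in> {1..r + 1}" "i \<noteq> i'"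
      and s: "s \<in> {1..t}" "s' \<in> {1..t}"
      unfolding balanced_complete_multipartite_def complete_multipartite_def by auto
    \<comment> \<open>A choice through both endpoints of the edge. At the other places it takes
      \<open>h j 1\<close>, which exists because t is positive; \<open>undefined\<close> outside
      {1..k} makes it extensional.\<close>
    define x where "x = (\<lambda>j. if j \<in> {1..k} then
      if j = g i then h (g i) s else if j = g i' then h (g i') s' else h j 1 else undefined)"
    have ne: "g i \<noteq> g i'" using ginj i by blast
    have "x \<in> PiE {1..k} T"
    proof (rule PiE_I)
      fix j assume "j \<in> {1..k}"
      then show "x j \<in> T j" using hT[of j] s t by (auto simp: x_def)
    qed (auto simp: x_def)
    from box[OF this] have "{x (g i), x (g i')} \<in> edges G"
      using gK(1) i ne by (auto simp: pairwise_def)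
    then show "?f ` e \<in> edges G" using gK(2) i ne by (simp add: e x_def)
  qed
qed

text \<open>If one fixed K spanned cliques in a proportion \<delta> / 2^k of the transversals, a box
  and hence a forbidden copy would appear. At most 2^k sets K are to be added up.\<close>

lemma few_transversals_with_clique:
  fixes \<delta> :: real
  assumes "0 < \<delta>" "0 < t"
  shows "\<exists>N. \<forall>n\<ge>N. \<forall>(V :: nat \<Rightarrow> 'v set) G. vertex_classes k n V \<longrightarrow> G \<in> multipartite_graphs k V \<longrightarrow>
    \<not> contains_copy G (balanced_complete_multipartite (r + 1) t) \<longrightarrow>
    real (card {v \<in> PiE {1..k} V. \<exists>K\<subseteq>{1..k}. card K = Suc r \<and> pairwise (\<lambda>i j. {v i, v j} \<in> edges G) K})
      \<le> \<delta> * real n ^ k"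
proof -
  have "\<delta> / 2 ^ k > 0" using assms by simp
  from dense_choices_contain_box[OF finite_atLeastAtMost this, of 1 k t]
  obtain N where N: "\<forall>n\<ge>N. \<forall>(V :: nat \<Rightarrow> 'v set) P.
    (\<forall>j\<in>{1..k}. finite (V j) \<and> card (V j) = n) \<longrightarrow>
    \<delta> / 2 ^ k * real n ^ card {1..k} \<le> real (card {x \<in> PiE {1..k} V. P x}) \<longrightarrow>
    (\<exists>T. (\<forall>j\<in>{1..k}. T j \<subseteq> V j \<and> card (T j) = t) \<and> (\<forall>x\<in>PiE {1..k} T. P x))"
    by (elim exE)
  show ?thesis
  proof (intro exI[of _ N] allI impI)
    fix n and V :: "nat \<Rightarrow> 'v set" and G
    assume n: "N \<le> n" and V: "vertex_classes k n V" and G: "G \<in> multipartite_graphs k V"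
      and free: "\<not> contains_copy G (balanced_complete_multipartite (r + 1) t)"
    let ?O = "PiE {1..k} V"
    define C where "C K = {v \<in> ?O. pairwise (\<lambda>i j. {v i, v j} \<in> edges G) K}" for K
    define F where "F = {K. K \<subseteq> {1..k} \<and> card K = Suc r}"
    have Vf: "\<forall>j\<in>{1..k}. finite (V j) \<and> card (V j) = n" using V by (simp add: vertex_classes_def)
    have small: "real (card (C K)) \<le> \<delta> / 2 ^ k * real n ^ k" if K: "K \<in> F" for K
    proof (rule ccontr)
      assume "\<not> ?thesis"
      then have "\<delta> / 2 ^ k * real n ^ card {1..k} \<le> real (card {x \<in> ?O. pairwise (\<lambda>i j. {x i, x j} \<in> edges G) K})"
        by (simp add: C_def)
      from N[THEN spec, THEN mp, OF n, THEN spec, THEN spec, THEN mp, OF Vf, THEN mp, OF this]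
      obtain T where T: "\<forall>j\<in>{1..k}. T j \<subseteq> V j \<and> card (T j) = t"
        "\<forall>x\<in>PiE {1..k} T. pairwise (\<lambda>i j. {x i, x j} \<in> edges G) K" by (elim exE conjE)
      have "contains_copy G (balanced_complete_multipartite (r + 1) t)"
      proof (rule contains_copy_from_box)
        show "disjoint_family_on V {1..k}" using V by (simp add: vertex_classes_def)
        show "(\<Union>j\<in>{1..k}. V j) \<subseteq> verts G" using G by (simp add: multipartite_graphs_def)
        show "K \<subseteq> {1..k}" "card K = r + 1" using K by (simp_all add: F_def)
        show "0 < t" by (rule assms(2))
        show "\<And>j. j \<in> {1..k} \<Longrightarrow> T j \<subseteq> V j \<and> card (T j) = t" by (rule T(1)[rule_format])
        show "\<And>x. x \<in> PiE {1..k} T \<Longrightarrow> pairwise (\<lambda>i j. {x i, x j} \<in> edges G) K"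
          by (rule T(2)[rule_format])
      qed
      then show False using free by simp
    qed
    have fF: "finite F" unfolding F_def by simp
    have "card F \<le> card (Pow {1..k})" unfolding F_def by (intro card_mono) auto
    then have "card F \<le> 2 ^ k" by (simp add: card_Pow)
    then have "real (card F) \<le> real (2 ^ k)" by (simp only: of_nat_le_iff)
    then have cF: "real (card F) \<le> 2 ^ k" by simp
    have "{v \<in> ?O. \<exists>K\<subseteq>{1..k}. card K = Suc r \<and> pairwise (\<lambda>i j. {v i, v j} \<in> edges G) K} = (\<Union>K\<in>F. C K)"
      unfolding C_def F_def by blast
    also have "real (card \<dots>) \<le> real (\<Sum>K\<in>F. card (C K))" by (intro of_nat_mono card_UN_le fF)
    also have "\<dots> = (\<Sum>K\<in>F. real (card (C K)))" by simp
    also have "\<dots> \<le> (\<Sum>K\<in>F. \<delta> / 2 ^ k * real n ^ k)" by (rule sum_mono) (rule small)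
    also have "\<dots> = real (card F) * (\<delta> / 2 ^ k * real n ^ k)" by simp
    also have "\<dots> \<le> 2 ^ k * (\<delta> / 2 ^ k * real n ^ k)" using cF assms by (intro mult_right_mono) auto
    finally show "real (card {v \<in> ?O. \<exists>K\<subseteq>{1..k}. card K = Suc r \<and> pairwise (\<lambda>i j. {v i, v j} \<in> edges G) K})
      \<le> \<delta> * real n ^ k" by simp
  qed
qed

text \<open>The sum of the induced degrees \<open>D v\<close> over all transversals is 2 e n^(k-2)
  in disguise, where e is the number of edges. Without a clique, \<open>D v\<close> is at most twice
  the Turan number, and at least 1 smaller if the induced graph is not Turan. Comparing with the
  assumed number of edges bounds the exceptions.\<close>

lemma few_non_turan_transversals:
  fixes \<epsilon> \<delta> :: real
  assumes "0 < r" "0 < n" "vertex_classes k n V" "E \<subseteq> edges (complete_multipartite k V)"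
    and cl: "real (card {v \<in> PiE {1..k} V. \<exists>K\<subseteq>{1..k}. card K = Suc r \<and> pairwise (\<lambda>i j. {v i, v j} \<in> E) K})
      \<le> \<delta> * real n ^ k"
  shows "(real (turan_edges r k) - \<epsilon>) * (real n)\<^sup>2 \<le> real (card E) \<Longrightarrow>
      real (card {v \<in> PiE {1..k} V. \<not> is_turan r k (\<lambda>i j. {v i, v j} \<in> E)})
        \<le> (2 * \<epsilon> + (real k ^ 2 + 1) * \<delta>) * real n ^ k"
    and "2 * real (card E) \<le> (2 * real (turan_edges r k) + (real k ^ 2 + 1) * \<delta>) * (real n)\<^sup>2"
proof -
  let ?O = "PiE {1..k} V"
  have Vf: "\<forall>j\<in>{1..k}. finite (V j) \<and> card (V j) = n" using assms(3) by (simp add: vertex_classes_def)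
  have fO: "finite ?O" using Vf by (intro finite_PiE) auto
  have cO: "card ?O = n ^ k" using Vf by (simp add: card_PiE)
  define D where "D v = card {(i, j) \<in> {1..k} \<times> {1..k}. {v i, v j} \<in> E}" for v
  define B where "B = {v \<in> ?O. \<not> is_turan r k (\<lambda>i j. {v i, v j} \<in> E)}"
  define C where "C = {v \<in> ?O. \<exists>K\<subseteq>{1..k}. card K = Suc r \<and> pairwise (\<lambda>i j. {v i, v j} \<in> E) K}"
  define t where "t = real (turan_edges r k)"
  have vV: "v i \<in> V i" if "v \<in> ?O" "i \<in> {1..k}" for v i using that by (rule PiE_mem)
  have "(\<Sum>v\<in>?O. D v) = (\<Sum>p\<in>{1..k} \<times> {1..k}. card {v \<in> ?O. {v (fst p), v (snd p)} \<in> E})"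
  proof -
    have "D v = card {p \<in> {1..k} \<times> {1..k}. {v (fst p), v (snd p)} \<in> E}" for v
      unfolding D_def by (rule arg_cong[of _ _ card]) auto
    then show ?thesis using sum_card_swap[of "{1..k} \<times> {1..k}" ?O "\<lambda>v p. {v (fst p), v (snd p)} \<in> E"] fO by simp
  qed
  also have "\<dots> = (\<Sum>i\<in>{1..k}. \<Sum>j\<in>{1..k}. card {v \<in> ?O. {v i, v j} \<in> E})"
    by (simp add: sum.cartesian_product split_def)
  finally have "(\<Sum>v\<in>?O. D v) * n ^ 2 = (\<Sum>i\<in>{1..k}. \<Sum>j\<in>{1..k}. card {v \<in> ?O. {v i, v j} \<in> E} * n ^ 2)"
    by (simp only: sum_distrib_right)
  also have "\<dots> = (\<Sum>i\<in>{1..k}. \<Sum>j\<in>{1..k}. card {(x, y) \<in> V i \<times> V j. {x, y} \<in> E} * n ^ k)"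
  proof (intro sum.cong refl)
    fix i j assume ij: "i \<in> {1..k}" "j \<in> {1..k}"
    show "card {v \<in> ?O. {v i, v j} \<in> E} * n ^ 2 = card {(x, y) \<in> V i \<times> V j. {x, y} \<in> E} * n ^ k"
    proof (cases "i = j")
      case True
      have "{v \<in> ?O. {v i, v j} \<in> E} = {}" "{(x, y) \<in> V i \<times> V j. {x, y} \<in> E} = {}"
        using True edge_of_classes[OF assms(3,4) _ ij] vV ij by blast+
      then show ?thesis by (simp only: card.empty mult_0)
    next
      case False
      show ?thesis using card_choices_pair[OF finite_atLeastAtMost ij False Vf, of "\<lambda>x y. {x, y} \<in> E"] by simp
    qed
  qed
  also have "\<dots> = 2 * card E * n ^ k"
    unfolding card_multipartite_edges[OF assms(3,4)] by (simp only: sum_distrib_right)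
  finally have "real ((\<Sum>v\<in>?O. D v) * n ^ 2) = real (2 * card E * n ^ k)" by (rule arg_cong)
  then have sumD: "(\<Sum>v\<in>?O. real (D v)) * (real n)\<^sup>2 = 2 * real (card E) * real n ^ k" by simp
  \<comment> \<open>The allowance k^2 + 1 covers the trivial bound \<open>D v\<close> \<le> k^2 and
    also the 1 subtracted in case v lies in B as well.\<close>
  have pt: "real (D v) \<le> 2 * t - (if v \<in> B then 1 else 0) + (if v \<in> C then real k ^ 2 + 1 else 0)"
    if v: "v \<in> ?O" for v
  proof (cases "v \<in> C")
    case True
    have "D v \<le> card ({1..k} \<times> {1..k})" unfolding D_def by (intro card_mono) auto
    then have "real (D v) \<le> real (k ^ 2)"
      unfolding of_nat_le_iff by (simp add: card_cartesian_product power2_eq_square)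
    then have "real (D v) \<le> real k ^ 2" by (simp only: of_nat_power)
    moreover have "t \<ge> 0" by (simp add: t_def)
    moreover have "(if v \<in> B then 1 else 0) \<le> (1 :: real)" by simp
    moreover have "(if v \<in> C then real k ^ 2 + 1 else 0) = real k ^ 2 + 1" using True by (rule if_P)
    ultimately show ?thesis by linarith
  next
    case False
    \<comment> \<open>Restricting to {1..k} makes irreflexivity hold for all indices, since inside
      {1..k} an edge joins different classes.\<close>
    define H where "H i j \<longleftrightarrow> i \<in> {1..k} \<and> j \<in> {1..k} \<and> {v i, v j} \<in> E" for i j
    have Dv: "D v = card {(i, j) \<in> {1..k} \<times> {1..k}. H i j}"
      unfolding D_def H_def by (rule arg_cong[of _ _ card]) auto
    have sH: "symp H" by (rule sympI) (auto simp: H_def insert_commute)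
    have iH: "irreflp H"
    proof (rule irreflpI)
      fix i show "\<not> H i i" using edge_of_classes[OF assms(3,4)] vV[OF v] unfolding H_def by blast
    qed
    have cH: "\<not> pairwise H K" if "K \<subseteq> {1..k}" "card K = Suc r" for K
    proof
      assume "pairwise H K"
      then have "pairwise (\<lambda>i j. {v i, v j} \<in> E) K" by (rule pairwise_mono) (auto simp: H_def)
      then show False using False v that by (auto simp: C_def)
    qed
    have le: "D v \<le> 2 * turan_edges r k" unfolding Dv by (rule turan_bound_and_uniqueness(1)[OF assms(1) sH iH cH])
    have "D v \<noteq> 2 * turan_edges r k" if "v \<in> B"
    proof
      assume "D v = 2 * turan_edges r k"
      then have "is_turan r k H"
        unfolding Dv using turan_bound_and_uniqueness(2)[OF assms(1) sH iH] cH by blast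
      then have "is_turan r k (\<lambda>i j. {v i, v j} \<in> E)" by (rule is_turan_cong) (simp add: H_def)
      then show False using that by (simp add: B_def)
    qed
    then have "real (D v) \<le> 2 * t - (if v \<in> B then 1 else 0)" using le unfolding t_def by auto
    then show ?thesis using False by simp
  qed
  have "(\<Sum>v\<in>?O. real (D v)) \<le>
      (\<Sum>v\<in>?O. 2 * t - (if v \<in> B then 1 else 0) + (if v \<in> C then real k ^ 2 + 1 else 0))"
    by (rule sum_mono) (rule pt)
  also have "\<dots> = 2 * t * real n ^ k - real (card B) + (real k ^ 2 + 1) * real (card C)"
  proof -
    have "?O \<inter> {v. v \<in> B} = B" "?O \<inter> {v. v \<in> C} = C" by (auto simp: B_def C_def)
    then show ?thesis using fO cO by (simp add: sum.distrib sum_subtractf sum.If_cases algebra_simps)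
  qed
  also have "\<dots> \<le> 2 * t * real n ^ k - real (card B) + (real k ^ 2 + 1) * (\<delta> * real n ^ k)"
    using cl by (intro add_left_mono mult_left_mono) (auto simp: C_def)
  finally have up: "(\<Sum>v\<in>?O. real (D v)) \<le> (2 * t + (real k ^ 2 + 1) * \<delta>) * real n ^ k - real (card B)"
    by (simp add: algebra_simps)
  have nk: "real n ^ k > 0" "(real n)\<^sup>2 > 0" using assms(2) by simp_all
  have "2 * real (card E) * real n ^ k \<le> (2 * t + (real k ^ 2 + 1) * \<delta>) * (real n)\<^sup>2 * real n ^ k"
  proof -
    have "(\<Sum>v\<in>?O. real (D v)) \<le> (2 * t + (real k ^ 2 + 1) * \<delta>) * real n ^ k" using up by simp
    then have "(\<Sum>v\<in>?O. real (D v)) * (real n)\<^sup>2 \<le> (2 * t + (real k ^ 2 + 1) * \<delta>) * real n ^ k * (real n)\<^sup>2"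
      using nk by (intro mult_right_mono) auto
    then show ?thesis unfolding sumD by (simp only: ac_simps)
  qed
  then show "2 * real (card E) \<le> (2 * real (turan_edges r k) + (real k ^ 2 + 1) * \<delta>) * (real n)\<^sup>2"
    using nk(1) unfolding t_def by (rule mult_right_le_imp_le)
  assume "(real (turan_edges r k) - \<epsilon>) * (real n)\<^sup>2 \<le> real (card E)"
  then have "2 * (t - \<epsilon>) * (real n)\<^sup>2 \<le> 2 * real (card E)"
    unfolding t_def[symmetric] mult.assoc by (rule mult_left_mono) simp
  then have "2 * (t - \<epsilon>) * (real n)\<^sup>2 * real n ^ k \<le> 2 * real (card E) * real n ^ k"
    by (rule mult_right_mono) simp
  then have "2 * (t - \<epsilon>) * real n ^ k * (real n)\<^sup>2 \<le> (\<Sum>v\<in>?O. real (D v)) * (real n)\<^sup>2"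
    unfolding sumD by (simp only: ac_simps)
  then have "2 * (t - \<epsilon>) * real n ^ k \<le> (\<Sum>v\<in>?O. real (D v))"
    using nk(2) by (rule mult_right_le_imp_le)
  then show "real (card {v \<in> ?O. \<not> is_turan r k (\<lambda>i j. {v i, v j} \<in> E)})
        \<le> (2 * \<epsilon> + (real k ^ 2 + 1) * \<delta>) * real n ^ k"
    using up unfolding B_def[symmetric] by (simp add: algebra_simps)
qed

subsection \<open>From labels to the Turan family\<close>

text \<open>Under the numbering \<sigma>, the i-th block consists of classes whose only label is i
  and becomes \<open>Z i\<close>. A label is allowed on at most one leftover class, so the leftover
  vertices labelled i lie in a single class and form \<open>W i\<close>. Hence \<open>U i\<close> is
  the colour class of i under \<phi>.\<close>

lemma turan_family_member_of_labelling:
  fixes V :: "nat \<Rightarrow> 'v set"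
  assumes r: "0 < r" "r \<le> k" and V: "vertex_classes k n V"
    and S: "\<And>j. j \<in> {1..k} \<Longrightarrow> S j \<noteq> {} \<and> S j \<subseteq> {1..r}"
    and bal: "\<And>s. (\<And>j. j \<in> {1..k} \<Longrightarrow> s j \<in> S j) \<Longrightarrow> balanced_colouring r k s"
    and \<phi>: "\<And>j x. j \<in> {1..k} \<Longrightarrow> \<phi> j x \<in> S j"
  shows "\<exists>T\<in>turan_family r k V. edges T \<subseteq> edges (complete_multipartite k V) \<and>
     (\<forall>i\<in>{1..k}. \<forall>j\<in>{1..k}. i \<noteq> j \<longrightarrow> (\<forall>x\<in>V i. \<forall>y\<in>V j. {x, y} \<in> edges T \<longleftrightarrow> \<phi> i x \<noteq> \<phi> j y))"
proof -
  define a where "a = k div r"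
  have ark: "a * r \<le> k" by (simp add: a_def)
  have a0: "0 < a" using r by (simp add: a_def div_greater_zero_iff)
  have "\<exists>\<sigma>. \<sigma> permutes {1..k} \<and>
     (\<forall>i\<in>{1..r}. \<forall>m\<in>{(i - 1) * a + 1..i * a}. S (\<sigma> m) = {i}) \<and>
     (\<forall>i\<in>{1..r}. \<forall>m\<in>{a * r + 1..k}. \<forall>m'\<in>{a * r + 1..k}.
        i \<in> S (\<sigma> m) \<longrightarrow> i \<in> S (\<sigma> m') \<longrightarrow> m = m')"
    unfolding a_def
  proof (rule balanced_selections_structure[OF r])
    show "S j \<noteq> {} \<and> S j \<subseteq> {1..r}" if "j \<in> {1..k}" for j using that by (rule S)
    show "balanced_colouring r k s" if "\<And>j. j \<in> {1..k} \<Longrightarrow> s j \<in> S j" for s using that by (rule bal)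
  qed
  then obtain \<sigma> where \<sigma>: "\<sigma> permutes {1..k}"
    and pure: "\<forall>i\<in>{1..r}. \<forall>m\<in>{(i - 1) * a + 1..i * a}. S (\<sigma> m) = {i}"
    and single: "\<forall>i\<in>{1..r}. \<forall>m\<in>{a * r + 1..k}. \<forall>m'\<in>{a * r + 1..k}.
        i \<in> S (\<sigma> m) \<longrightarrow> i \<in> S (\<sigma> m') \<longrightarrow> m = m'"
    by (elim exE conjE)
  have \<sigma>k: "\<sigma> m \<in> {1..k}" if "m \<in> {1..k}" for m using permutes_in_image[OF \<sigma>] that by blast
  have \<sigma>inv: "\<exists>m\<in>{1..k}. \<sigma> m = j" if "j \<in> {1..k}" for j
    using permutes_image[OF \<sigma>] that by (metis imageE)
  have disj: "i = j" if "x \<in> V i" "x \<in> V j" "i \<in> {1..k}" "j \<in> {1..k}" for x i j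
    using V that unfolding vertex_classes_def disjoint_family_on_def by blast
  define U where "U i = {x. \<exists>j\<in>{1..k}. x \<in> V j \<and> \<phi> j x = i}" for i
  define W where "W i = {x. \<exists>m\<in>{a * r + 1..k}. x \<in> V (\<sigma> m) \<and> \<phi> (\<sigma> m) x = i}" for i
  define Z where "Z i = (\<Union>m\<in>{(i - 1) * a + 1..i * a}. (V \<circ> \<sigma>) m)" for i
  define T where "T = (\<Union>j\<in>{1..k}. (V \<circ> \<sigma>) j,
      edges (complete_multipartite r U) \<inter> edges (complete_multipartite k (V \<circ> \<sigma>)))"
  have \<phi>U: "x \<in> U i \<longleftrightarrow> \<phi> j x = i" if "x \<in> V j" "j \<in> {1..k}" for x i j
    using that disj[OF that(1)] unfolding U_def by blast
  have left: "m \<in> {1..k}" if "m \<in> {a * r + 1..k}" for m using that by auto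
  have block: "m \<in> {1..k}" if "i \<in> {1..r}" "m \<in> {(i - 1) * a + 1..i * a}" for i m
  proof -
    have "i * a \<le> r * a" using that by (intro mult_le_mono1) simp
    also have "\<dots> \<le> k" using ark by (simp only: mult.commute)
    finally show ?thesis using that by auto
  qed
  have in_block: "\<exists>i\<in>{1..r}. m \<in> {(i - 1) * a + 1..i * a}" if "m \<in> {1..k}" "m \<notin> {a * r + 1..k}" for m
  proof -
    \<comment> \<open>Blocks are numbered from 1, so m lies in block d + 1.\<close>
    obtain d where d: "d = (m - 1) div a" by blast
    have m: "1 \<le> m" "m \<le> r * a" using that by (auto simp: mult.commute)
    then have "m - 1 < r * a" by linarith
    then have "d < r" unfolding d by (rule less_mult_imp_div_less)
    moreover have "d * a \<le> m - 1" unfolding d by (rule div_times_less_eq_dividend)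
    then have "d * a + 1 \<le> m" using m(1) by linarith
    moreover have "m - 1 < d * a + a"
      using dividend_less_div_times[OF a0, of "m - 1"] unfolding d by linarith
    then have "m \<le> (d + 1) * a" by (simp add: distrib_right)
    ultimately show ?thesis by (intro bexI[of _ "d + 1"]) auto
  qed
  have UWZ: "U i = W i \<union> Z i" if i: "i \<in> {1..r}" for i
  proof (intro equalityI subsetI)
    fix x assume "x \<in> U i"
    then obtain j where j: "j \<in> {1..k}" "x \<in> V j" "\<phi> j x = i" unfolding U_def by blast
    obtain m where m: "m \<in> {1..k}" "\<sigma> m = j" using \<sigma>inv[OF j(1)] by blast
    show "x \<in> W i \<union> Z i"
    proof (cases "m \<in> {a * r + 1..k}")
      case True
      then show ?thesis using j m unfolding W_def by blast
    next
      case False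
      then obtain i' where i': "i' \<in> {1..r}" "m \<in> {(i' - 1) * a + 1..i' * a}"
        using in_block[OF m(1)] by blast
      then have "S j = {i'}" using pure m(2) by blast
      then have "i' = i" using \<phi>[OF j(1), of x] j(3) by simp
      then have "x \<in> Z i" using i' j(2) m(2) unfolding Z_def by auto
      then show ?thesis by simp
    qed
  next
    fix x assume "x \<in> W i \<union> Z i"
    then show "x \<in> U i"
    proof
      assume "x \<in> W i"
      then show ?thesis using \<sigma>k left unfolding W_def U_def by blast
    next
      assume "x \<in> Z i"
      then obtain m where m: "m \<in> {(i - 1) * a + 1..i * a}" "x \<in> V (\<sigma> m)" unfolding Z_def by auto
      have mk: "\<sigma> m \<in> {1..k}" by (rule \<sigma>k[OF block[OF i m(1)]])
      have "S (\<sigma> m) = {i}" using pure i m(1) by blast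
      then have "\<phi> (\<sigma> m) x = i" using \<phi>[OF mk, of x] by simp
      then show ?thesis using mk m(2) unfolding U_def by blast
    qed
  qed
  have disjW: "disjoint_family_on W {1..r}"
    unfolding disjoint_family_on_def
  proof (intro ballI impI)
    fix i i' :: nat assume "i \<noteq> i'"
    moreover have "i = i'" if x: "x \<in> W i" "x \<in> W i'" for x
    proof -
      obtain m m' where m: "m \<in> {a * r + 1..k}" "x \<in> V (\<sigma> m)" "\<phi> (\<sigma> m) x = i"
        and m': "m' \<in> {a * r + 1..k}" "x \<in> V (\<sigma> m')" "\<phi> (\<sigma> m') x = i'"
        using x unfolding W_def by blast
      have "\<sigma> m = \<sigma> m'" by (rule disj[OF m(2) m'(2) \<sigma>k[OF left[OF m(1)]] \<sigma>k[OF left[OF m'(1)]]])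
      then show "i = i'" using m(3) m'(3) by simp
    qed
    ultimately show "W i \<inter> W i' = {}" by blast
  qed
  have coverW: "(\<Union>i\<in>{1..r}. W i) = (\<Union>m\<in>{a * r + 1..k}. (V \<circ> \<sigma>) m)"
  proof (intro equalityI subsetI)
    fix x assume "x \<in> (\<Union>i\<in>{1..r}. W i)"
    then show "x \<in> (\<Union>m\<in>{a * r + 1..k}. (V \<circ> \<sigma>) m)" unfolding W_def by auto
  next
    fix x assume "x \<in> (\<Union>m\<in>{a * r + 1..k}. (V \<circ> \<sigma>) m)"
    then obtain m where m: "m \<in> {a * r + 1..k}" "x \<in> V (\<sigma> m)" by auto
    have mk: "\<sigma> m \<in> {1..k}" by (rule \<sigma>k[OF left[OF m(1)]])
    then have "\<phi> (\<sigma> m) x \<in> {1..r}" using \<phi>[OF mk] S[OF mk] by blast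
    then show "x \<in> (\<Union>i\<in>{1..r}. W i)" using m unfolding W_def by blast
  qed
  have oneW: "\<exists>j\<in>{1..k}. W i \<subseteq> (V \<circ> \<sigma>) j" if i: "i \<in> {1..r}" for i
  proof (cases "W i = {}")
    case True
    have "1 \<in> {1..k}" using r by simp
    then show ?thesis using True by blast
  next
    case False
    then obtain x m where m: "m \<in> {a * r + 1..k}" "\<phi> (\<sigma> m) x = i" unfolding W_def by blast
    have iS: "i \<in> S (\<sigma> m)" using \<phi>[OF \<sigma>k[OF left[OF m(1)]], of x] m(2) by simp
    have "W i \<subseteq> (V \<circ> \<sigma>) m"
    proof
      fix x' assume "x' \<in> W i"
      then obtain m' where m': "m' \<in> {a * r + 1..k}" "x' \<in> V (\<sigma> m')" "\<phi> (\<sigma> m') x' = i"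
        unfolding W_def by blast
      have "i \<in> S (\<sigma> m')" using \<phi>[OF \<sigma>k[OF left[OF m'(1)]], of x'] m'(3) by simp
      then have "m = m'" using single i m(1) m'(1) iS by blast
      then show "x' \<in> (V \<circ> \<sigma>) m" using m'(2) by simp
    qed
    then show ?thesis using left[OF m(1)] by blast
  qed
  have "T \<in> labelled_turan_family r k (V \<circ> \<sigma>)"
    unfolding labelled_turan_family_def Let_def a_def[symmetric] mem_Collect_eq
    by (intro exI[of _ W] exI[of _ Z] exI[of _ U] conjI ballI)
       (use disjW coverW oneW UWZ in \<open>simp_all only: Z_def T_def\<close>)
  then have TF: "T \<in> turan_family r k V" using \<sigma> unfolding turan_family_def by blast
  have cm: "{x, y} \<in> edges (complete_multipartite k (V \<circ> \<sigma>))"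
    if ij: "i \<in> {1..k}" "j \<in> {1..k}" "i \<noteq> j" and "x \<in> V i" "y \<in> V j" for x y i j
  proof -
    obtain m where "m \<in> {1..k}" "\<sigma> m = i" using \<sigma>inv[OF ij(1)] by blast
    moreover obtain m' where "m' \<in> {1..k}" "\<sigma> m' = j" using \<sigma>inv[OF ij(2)] by blast
    ultimately show ?thesis using that unfolding edge_complete_multipartite_iff
      by (intro bexI[of _ m] bexI[of _ m']) auto
  qed
  have "edges T \<subseteq> edges (complete_multipartite k V)"
  proof
    fix e assume e: "e \<in> edges T"
    then obtain x y where xy: "e = {x, y}" unfolding T_def complete_multipartite_def by auto
    then have "{x, y} \<in> edges (complete_multipartite k (V \<circ> \<sigma>))" using e by (simp add: T_def)
    then obtain m m' where m: "m \<in> {1..k}" "m' \<in> {1..k}" "m \<noteq> m'" "x \<in> V (\<sigma> m)" "y \<in> V (\<sigma> m')"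
      unfolding edge_complete_multipartite_iff by auto
    have "\<sigma> m \<noteq> \<sigma> m'" using m(3) injD[OF permutes_inj[OF \<sigma>]] by blast
    then show "e \<in> edges (complete_multipartite k V)"
      unfolding xy edge_complete_multipartite_iff using m \<sigma>k by blast
  qed
  moreover have "{x, y} \<in> edges T \<longleftrightarrow> \<phi> i x \<noteq> \<phi> j y"
    if ij: "i \<in> {1..k}" "j \<in> {1..k}" "i \<noteq> j" and xy: "x \<in> V i" "y \<in> V j" for i j x y
  proof -
    have lr: "\<phi> i x \<in> {1..r}" "\<phi> j y \<in> {1..r}" using \<phi> S ij by blast+
    have "{x, y} \<in> edges T \<longleftrightarrow> {x, y} \<in> edges (complete_multipartite r U)"
      using cm[OF ij xy] by (simp add: T_def)
    also have "\<dots> \<longleftrightarrow> (\<exists>p\<in>{1..r}. \<exists>q\<in>{1..r}. p \<noteq> q \<and> \<phi> i x = p \<and> \<phi> j y = q)"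
      unfolding edge_complete_multipartite_iff \<phi>U[OF xy(1) ij(1)] \<phi>U[OF xy(2) ij(2)] by (rule refl)
    also have "\<dots> \<longleftrightarrow> \<phi> i x \<noteq> \<phi> j y" using lr by blast
    finally show ?thesis .
  qed
  ultimately show ?thesis using TF by blast
qed

lemma balanced_colouring_cong:
  assumes "balanced_colouring r k c" "\<And>j. j \<in> {1..k} \<Longrightarrow> c j = d j"
  shows "balanced_colouring r k d"
proof -
  have "c ` {1..k} = d ` {1..k}" using assms(2) by (intro image_cong) auto
  moreover have "{j \<in> {1..k}. c j = i} = {j \<in> {1..k}. d j = i}" for i using assms(2) by auto
  ultimately show ?thesis using assms(1) unfolding balanced_colouring_def by simp
qed

text \<open>A selection of labels of frequency at least \<eta> has more than \<theta> n^k
  realisations, so one of them is good and the selection is balanced. Relabelling the vertices with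
  rare labels moves at most r \<eta> n vertices per class; together with the \<theta> n^2 pairs
  violating the label rule this bounds the difference between two classes.\<close>

lemma close_to_turan_family_of_labelling:
  fixes V :: "nat \<Rightarrow> 'v set" and G :: "'v graph" and \<theta> \<eta> :: real
  assumes r: "0 < r" "r \<le> k" and n: "0 < n" and V: "vertex_classes k n V"
    and G: "G \<in> multipartite_graphs k V"
    and lab: "\<And>j x. lab j x \<in> {1..r}"
    and bad: "real (card {w \<in> PiE {1..k} V. \<not> good w}) \<le> \<theta> * real n ^ k"
    and good: "\<And>w. w \<in> PiE {1..k} V \<Longrightarrow> good w \<Longrightarrow> balanced_colouring r k (\<lambda>j. lab j (w j)) \<and>
      (\<forall>i\<in>{1..k}. \<forall>j\<in>{1..k}. {w i, w j} \<in> edges G \<longleftrightarrow> lab i (w i) \<noteq> lab j (w j))"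
    and \<eta>: "0 < \<eta>" "\<eta> * real r \<le> 1" "\<theta> < \<eta> ^ k"
    and \<gamma>: "real k ^ 2 * (\<theta> + 2 * real r * \<eta>) \<le> 2 * \<gamma>"
  shows "\<exists>T\<in>turan_family r k V. close \<gamma> n G T"
proof -
  have Vf: "\<forall>j\<in>{1..k}. finite (V j) \<and> card (V j) = n" using V by (simp add: vertex_classes_def)
  have n0: "0 < real n" using n by simp
  define X where "X j l = {x \<in> V j. lab j x = l}" for j l
  define S where "S j = {l \<in> {1..r}. \<eta> * real n \<le> real (card (X j l))}" for j
  have Xf: "finite (X j l)" if "j \<in> {1..k}" for j l using Vf that by (simp add: X_def)
  have Sne: "S j \<noteq> {}" if j: "j \<in> {1..k}" for j
  proof
    assume "S j = {}"
    then have lt: "real (card (X j l)) < \<eta> * real n" if "l \<in> {1..r}" for l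
      using that unfolding S_def by force
    have "V j = (\<Union>l\<in>{1..r}. X j l)" using lab unfolding X_def by blast
    moreover have "n = card (V j)" using bspec[OF Vf j] by simp
    ultimately have "n = card (\<Union>l\<in>{1..r}. X j l)" by (rule back_subst[of "\<lambda>A. n = card A", rotated])
    also have "\<dots> \<le> (\<Sum>l\<in>{1..r}. card (X j l))" by (rule card_UN_le) simp
    finally have "real n \<le> real (\<Sum>l\<in>{1..r}. card (X j l))" by (simp only: of_nat_le_iff)
    also have "\<dots> = (\<Sum>l\<in>{1..r}. real (card (X j l)))" by (rule of_nat_sum)
    also have "\<dots> < (\<Sum>l\<in>{1..r}. \<eta> * real n)" using lt r by (intro sum_strict_mono) auto
    also have "\<dots> = \<eta> * real r * real n" by simp
    also have "\<dots> \<le> 1 * real n" using \<eta>(2) by (rule mult_right_mono) simp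
    finally show False by simp
  qed
  have S: "S j \<noteq> {} \<and> S j \<subseteq> {1..r}" if "j \<in> {1..k}" for j
    using Sne[OF that] by (auto simp: S_def)
  have bal: "balanced_colouring r k s" if s: "\<And>j. j \<in> {1..k} \<Longrightarrow> s j \<in> S j" for s
  proof -
    let ?P = "PiE {1..k} (\<lambda>j. X j (s j))"
    have sub: "?P \<subseteq> PiE {1..k} V" by (rule PiE_mono) (simp add: X_def)
    have "\<theta> * real n ^ k < \<eta> ^ k * real n ^ k" using \<eta>(3) n0 by simp
    also have "\<dots> = (\<Prod>j\<in>{1..k}. \<eta> * real n)" by (simp add: power_mult_distrib)
    also have "\<dots> \<le> (\<Prod>j\<in>{1..k}. real (card (X j (s j))))"
      using s \<eta>(1) by (intro prod_mono) (auto simp: S_def)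
    also have "\<dots> = real (card ?P)" by (simp add: card_PiE)
    finally have lt: "\<theta> * real n ^ k < real (card ?P)" .
    have "\<exists>w\<in>?P. good w"
    proof (rule ccontr)
      assume "\<not> ?thesis"
      then have "?P \<subseteq> {w \<in> PiE {1..k} V. \<not> good w}" using sub by blast
      moreover have "finite {w \<in> PiE {1..k} V. \<not> good w}"
        using Vf by (intro finite_subset[OF _ finite_PiE[of "{1..k}" V]]) auto
      ultimately have "card ?P \<le> card {w \<in> PiE {1..k} V. \<not> good w}" by (intro card_mono)
      then show False using lt bad by linarith
    qed
    then obtain w where w: "w \<in> ?P" "good w" by blast
    then have "balanced_colouring r k (\<lambda>j. lab j (w j))" using good sub by blast
    then show ?thesis
    proof (rule balanced_colouring_cong)
      fix j assume "j \<in> {1..k}"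
      then show "lab j (w j) = s j" using PiE_mem[OF w(1)] by (simp add: X_def)
    qed
  qed
  \<comment> \<open>A vertex with a rare label may receive any frequent one of its class, since such
    vertices are few and are paid for in the error term.\<close>
  define \<phi> where "\<phi> j x = (if lab j x \<in> S j then lab j x else SOME l. l \<in> S j)" for j x
  have \<phi>: "\<phi> j x \<in> S j" if "j \<in> {1..k}" for j x
    using Sne[OF that] some_in_eq[of "S j"] by (simp add: \<phi>_def)
  have "\<exists>T\<in>turan_family r k V. edges T \<subseteq> edges (complete_multipartite k V) \<and>
     (\<forall>i\<in>{1..k}. \<forall>j\<in>{1..k}. i \<noteq> j \<longrightarrow> (\<forall>x\<in>V i. \<forall>y\<in>V j. {x, y} \<in> edges T \<longleftrightarrow> \<phi> i x \<noteq> \<phi> j y))"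
  proof (rule turan_family_member_of_labelling[OF r V])
    show "S j \<noteq> {} \<and> S j \<subseteq> {1..r}" if "j \<in> {1..k}" for j using that by (rule S)
    show "balanced_colouring r k s" if "\<And>j. j \<in> {1..k} \<Longrightarrow> s j \<in> S j" for s using that by (rule bal)
    show "\<phi> j x \<in> S j" if "j \<in> {1..k}" for j x using that by (rule \<phi>)
  qed
  then obtain T where T: "T \<in> turan_family r k V" "edges T \<subseteq> edges (complete_multipartite k V)"
    and Te: "\<And>i j x y. i \<in> {1..k} \<Longrightarrow> j \<in> {1..k} \<Longrightarrow> i \<noteq> j \<Longrightarrow> x \<in> V i \<Longrightarrow> y \<in> V j \<Longrightarrow>
       {x, y} \<in> edges T \<longleftrightarrow> \<phi> i x \<noteq> \<phi> j y" by blast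
  define D where "D = (edges G - edges T) \<union> (edges T - edges G)"
  have GD: "edges G \<subseteq> edges (complete_multipartite k V)" using G by (simp add: multipartite_graphs_def)
  have DV: "D \<subseteq> edges (complete_multipartite k V)" using GD T(2) by (auto simp: D_def)
  define C where "C j = {x \<in> V j. \<phi> j x \<noteq> lab j x}" for j
  have C: "real (card (C j)) \<le> real r * (\<eta> * real n)" if j: "j \<in> {1..k}" for j
  proof -
    let ?L = "{1..r} - S j"
    have "C j \<subseteq> (\<Union>l\<in>?L. X j l)" using lab by (auto simp: C_def \<phi>_def X_def)
    then have "card (C j) \<le> card (\<Union>l\<in>?L. X j l)" using Xf[OF j] by (intro card_mono) auto
    also have "\<dots> \<le> (\<Sum>l\<in>?L. card (X j l))" by (rule card_UN_le) simp
    finally have "real (card (C j)) \<le> real (\<Sum>l\<in>?L. card (X j l))" by (simp only: of_nat_le_iff)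
    also have "\<dots> = (\<Sum>l\<in>?L. real (card (X j l)))" by (rule of_nat_sum)
    also have "\<dots> \<le> (\<Sum>l\<in>?L. \<eta> * real n)" by (rule sum_mono) (auto simp: S_def)
    also have "\<dots> = real (card ?L) * (\<eta> * real n)" by simp
    also have "\<dots> \<le> real r * (\<eta> * real n)"
    proof (rule mult_right_mono)
      have "card ?L \<le> card {1..r}" by (intro card_mono) auto
      then show "real (card ?L) \<le> real r" by simp
    qed (use \<eta>(1) in simp)
    finally show ?thesis .
  qed
  have pair: "real (card {(x, y) \<in> V i \<times> V j. {x, y} \<in> D}) \<le> (\<theta> + 2 * real r * \<eta>) * (real n)\<^sup>2"
    if ij: "i \<in> {1..k}" "j \<in> {1..k}" for i j
  proof (cases "i = j")
    case True
    have "{(x, y) \<in> V i \<times> V j. {x, y} \<in> D} = {}"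
      using edge_of_classes[OF V DV _ ij] True by blast
    then have z: "card {(x, y) \<in> V i \<times> V j. {x, y} \<in> D} = 0" by (simp only: card.empty)
    \<comment> \<open>Nothing is assumed about the sign of \<theta>; it follows from the bound on
      bad transversals.\<close>
    have "0 \<le> real (card {w \<in> PiE {1..k} V. \<not> good w})" by simp
    then have "0 \<le> \<theta> * real n ^ k" using bad by linarith
    then have "0 \<le> \<theta>" using mult_right_le_imp_le[of 0 "real n ^ k" \<theta>] n0 by simp
    then show ?thesis unfolding z using \<eta>(1) by simp
  next
    case False
    \<comment> \<open>Pairs on which G disobeys the label rule. Every transversal through such a
      pair is bad, so their proportion among all pairs is at most \<theta>.\<close>
    define Q where "Q x y \<longleftrightarrow> \<not> ({x, y} \<in> edges G \<longleftrightarrow> lab i x \<noteq> lab j y)" for x y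
    let ?Q = "{(x, y) \<in> V i \<times> V j. Q x y}"
    have fV: "finite (V i)" "finite (V j)" and cV: "card (V i) = n" "card (V j) = n" using Vf ij by auto
    have "{v \<in> PiE {1..k} V. Q (v i) (v j)} \<subseteq> {w \<in> PiE {1..k} V. \<not> good w}"
      using good ij unfolding Q_def by blast
    then have "card {v \<in> PiE {1..k} V. Q (v i) (v j)} \<le> card {w \<in> PiE {1..k} V. \<not> good w}"
      using Vf by (intro card_mono finite_subset[OF _ finite_PiE[of "{1..k}" V]]) auto
    then have "real (card {v \<in> PiE {1..k} V. Q (v i) (v j)}) \<le> \<theta> * real n ^ k" using bad by linarith
    then have "real (card {v \<in> PiE {1..k} V. Q (v i) (v j)}) * (real n)\<^sup>2 \<le> \<theta> * real n ^ k * (real n)\<^sup>2"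
      by (rule mult_right_mono) simp
    moreover have "real (card {v \<in> PiE {1..k} V. Q (v i) (v j)}) * (real n)\<^sup>2 = real (card ?Q) * real n ^ k"
      using arg_cong[OF card_choices_pair[OF finite_atLeastAtMost ij False Vf, of Q], of real] by simp
    ultimately have "real (card ?Q) * real n ^ k \<le> \<theta> * (real n)\<^sup>2 * real n ^ k" by (simp only: ac_simps)
    then have cQ: "real (card ?Q) \<le> \<theta> * (real n)\<^sup>2" by (rule mult_right_le_imp_le) (use n0 in simp)
    have "{(x, y) \<in> V i \<times> V j. {x, y} \<in> D} \<subseteq> ?Q \<union> (C i \<times> V j \<union> V i \<times> C j)"
    proof
      fix p assume "p \<in> {(x, y) \<in> V i \<times> V j. {x, y} \<in> D}"
      then obtain x y where p: "p = (x, y)" "x \<in> V i" "y \<in> V j" "{x, y} \<in> D" by blast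
      have "Q x y" if "\<phi> i x = lab i x" "\<phi> j y = lab j y"
        using Te[OF ij False p(2,3)] p(4) that unfolding Q_def D_def by auto
      then show "p \<in> ?Q \<union> (C i \<times> V j \<union> V i \<times> C j)" using p unfolding C_def by blast
    qed
    then have "card {(x, y) \<in> V i \<times> V j. {x, y} \<in> D} \<le> card (?Q \<union> (C i \<times> V j \<union> V i \<times> C j))"
      using fV by (intro card_mono) (auto simp: finite_pairs C_def)
    also have "\<dots> \<le> card ?Q + card (C i \<times> V j \<union> V i \<times> C j)" by (rule card_Un_le)
    also have "\<dots> \<le> card ?Q + (card (C i \<times> V j) + card (V i \<times> C j))"
      by (rule add_left_mono) (rule card_Un_le)
    also have "\<dots> = card ?Q + (card (C i) * n + n * card (C j))"
      by (simp only: card_cartesian_product cV)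
    finally have "real (card {(x, y) \<in> V i \<times> V j. {x, y} \<in> D})
       \<le> real (card ?Q + (card (C i) * n + n * card (C j)))" by (simp only: of_nat_le_iff)
    also have "\<dots> = real (card ?Q) + (real (card (C i)) * real n + real (card (C j)) * real n)" by simp
    also have "\<dots> \<le> \<theta> * (real n)\<^sup>2 + (real r * (\<eta> * real n) * real n + real r * (\<eta> * real n) * real n)"
      using cQ C[OF ij(1)] C[OF ij(2)] by (intro add_mono mult_right_mono) auto
    also have "\<dots> = (\<theta> + 2 * real r * \<eta>) * (real n)\<^sup>2" by (simp add: algebra_simps power2_eq_square)
    finally show ?thesis .
  qed
  \<comment> \<open>Each differing edge is counted in both orders; this is the source of the factor
    2 next to \<gamma> in the hypothesis.\<close>
  have "2 * real (card D) = real (2 * card D)" by simp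
  also have "\<dots> = (\<Sum>i\<in>{1..k}. \<Sum>j\<in>{1..k}. real (card {(x, y) \<in> V i \<times> V j. {x, y} \<in> D}))"
    unfolding card_multipartite_edges[OF V DV] of_nat_sum by (rule refl)
  also have "\<dots> \<le> (\<Sum>i\<in>{1..k}. \<Sum>j\<in>{1..k}. (\<theta> + 2 * real r * \<eta>) * (real n)\<^sup>2)"
    by (intro sum_mono pair)
  also have "\<dots> = real k ^ 2 * (\<theta> + 2 * real r * \<eta>) * (real n)\<^sup>2" by (simp add: power2_eq_square)
  also have "\<dots> \<le> 2 * \<gamma> * (real n)\<^sup>2" using \<gamma> by (rule mult_right_mono) simp
  finally have "real (card D) \<le> \<gamma> * (real n)\<^sup>2" by simp
  then have "close \<gamma> n G T" by (simp add: close_def D_def)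
  then show ?thesis using T(1) by blast
qed

section \<open>Choice of the constants and conclusion\<close>

theorem theorem3p2:
  fixes k r t :: nat and \<gamma> :: real
  assumes "0 < r" and "0 < t" and "r < k" and "0 < \<gamma>"
  shows "\<exists>\<epsilon>>0. \<exists>n0::nat. \<forall>n\<ge>n0. \<forall>(V :: nat \<Rightarrow> 'v set) G.
           vertex_classes k n V \<longrightarrow>
           G \<in> multipartite_graphs k V \<longrightarrow>
           \<not> contains_copy G (balanced_complete_multipartite (r + 1) t) \<longrightarrow>
           real (card (edges G)) \<ge> (real (turan_edges r k) - \<epsilon>) * (real n)\<^sup>2 \<longrightarrow>
             (\<exists>T\<in>turan_family r k V. close \<gamma> n G T) \<and>
             real (card (edges G)) \<le> (real (turan_edges r k) + \<gamma>) * (real n)\<^sup>2"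
proof -
  have r: "0 < real r" "1 \<le> real k" and k: "0 < real k ^ 2" using assms by auto
  \<comment> \<open>The first bound guarantees a frequent label in every class; the second lets the
    relabelled vertices cost at most \<gamma> after summing over k^2 pairs of classes.\<close>
  define \<eta> where "\<eta> = min (1 / real r) (\<gamma> / (2 * real r * real k ^ 2))"
  \<comment> \<open>Strictly below \<eta>^k, so that good transversals realise every frequent
    selection; the second bound leaves another \<gamma> for the pairs violating the label
    rule.\<close>
  define \<theta> where "\<theta> = min (\<eta> ^ k / 2) (\<gamma> / real k ^ 2)"
  \<comment> \<open>The admissible proportion of non-Turan transversals: passing to mixtures costs a
    factor 2^k.\<close>
  define \<beta> where "\<beta> = \<theta> / 2 ^ k"
  \<comment> \<open>Missing edges contribute 2 \<epsilon> and transversals with cliques (k^2 + 1)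
    \<delta>; each receives half of \<beta>.\<close>
  define \<epsilon> where "\<epsilon> = \<beta> / 4"
  define \<delta> where "\<delta> = \<beta> / (2 * (real k ^ 2 + 1))"
  have \<eta>0: "0 < \<eta>" using assms(4) r k by (simp add: \<eta>_def)
  then have \<theta>0: "0 < \<theta>" using assms(4) k by (simp add: \<theta>_def)
  then have \<beta>0: "0 < \<beta>" by (simp add: \<beta>_def)
  have \<eta>r: "\<eta> * real r \<le> 1"
  proof -
    have "\<eta> \<le> 1 / real r" by (simp add: \<eta>_def)
    then show ?thesis using r(1) by (simp add: pos_le_divide_eq)
  qed
  have "\<theta> \<le> \<eta> ^ k / 2" unfolding \<theta>_def by (rule min.cobounded1)
  moreover have "0 < \<eta> ^ k" using \<eta>0 by simp
  ultimately have \<theta>\<eta>: "\<theta> < \<eta> ^ k" by linarith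
  have "\<theta> \<le> \<gamma> / real k ^ 2" unfolding \<theta>_def by (rule min.cobounded2)
  then have \<theta>k: "real k ^ 2 * \<theta> \<le> \<gamma>" using k by (simp add: pos_le_divide_eq mult.commute)
  have "\<eta> \<le> \<gamma> / (2 * real r * real k ^ 2)" unfolding \<eta>_def by (rule min.cobounded2)
  then have "\<eta> * (2 * real r * real k ^ 2) \<le> \<gamma>"
    using r k by (subst (asm) pos_le_divide_eq) auto
  then have \<gamma>2: "real k ^ 2 * (\<theta> + 2 * real r * \<eta>) \<le> 2 * \<gamma>" using \<theta>k by (simp add: algebra_simps)
  have k1: "0 < real k ^ 2 + 1" using k by linarith
  have \<epsilon>0: "0 < \<epsilon>" using \<beta>0 by (simp add: \<epsilon>_def)
  have \<delta>0: "0 < \<delta>" using \<beta>0 k1 by (simp add: \<delta>_def)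
  have k\<delta>: "(real k ^ 2 + 1) * \<delta> = \<beta> / 2" unfolding \<delta>_def using k1 by (simp add: field_simps)
  have \<beta>\<epsilon>: "2 * \<epsilon> + (real k ^ 2 + 1) * \<delta> = \<beta>" unfolding k\<delta> by (simp add: \<epsilon>_def)
  have "\<beta> \<le> \<theta>" using \<theta>0 unfolding \<beta>_def by (simp add: divide_le_eq)
  also have "\<theta> \<le> real k ^ 2 * \<theta>" using \<theta>0 r(2) by (simp add: one_le_power)
  finally have \<beta>\<gamma>: "\<beta> \<le> \<gamma>" using \<theta>k by linarith
  obtain N where N: "\<forall>n\<ge>N. \<forall>(V :: nat \<Rightarrow> 'v set) G. vertex_classes k n V \<longrightarrow> G \<in> multipartite_graphs k V \<longrightarrow>
    \<not> contains_copy G (balanced_complete_multipartite (r + 1) t) \<longrightarrow>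
    real (card {v \<in> PiE {1..k} V. \<exists>K\<subseteq>{1..k}. card K = Suc r \<and> pairwise (\<lambda>i j. {v i, v j} \<in> edges G) K})
      \<le> \<delta> * real n ^ k"
    using few_transversals_with_clique[OF \<delta>0 assms(2), where k = k and r = r and ?'v = 'v] by (elim exE)
  show ?thesis
  \<comment> \<open>Taking n \<ge> 1 ensures that transversals exist and that n^k can be
    cancelled.\<close>
  proof (intro exI[of _ \<epsilon>] conjI[OF \<epsilon>0] exI[of _ "max N 1"] allI impI)
    fix n and V :: "nat \<Rightarrow> 'v set" and G
    assume "max N 1 \<le> n" and V: "vertex_classes k n V" and G: "G \<in> multipartite_graphs k V"
      and free: "\<not> contains_copy G (balanced_complete_multipartite (r + 1) t)"
      and many: "(real (turan_edges r k) - \<epsilon>) * (real n)\<^sup>2 \<le> real (card (edges G))"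
    then have n: "N \<le> n" "0 < n" by auto
    let ?O = "PiE {1..k} V"
    define Q where "Q v \<longleftrightarrow> is_turan r k (\<lambda>i j. {v i, v j} \<in> edges G)" for v
    have E: "edges G \<subseteq> edges (complete_multipartite k V)" using G by (simp add: multipartite_graphs_def)
    have cl: "real (card {v \<in> ?O. \<exists>K\<subseteq>{1..k}. card K = Suc r \<and> pairwise (\<lambda>i j. {v i, v j} \<in> edges G) K})
      \<le> \<delta> * real n ^ k"
      using N[THEN spec, THEN mp, OF n(1), THEN spec, THEN spec, THEN mp, OF V, THEN mp, OF G, THEN mp, OF free] .
    note few = few_non_turan_transversals[OF assms(1) n(2) V E cl]
    have Vf: "\<forall>j\<in>{1..k}. finite (V j) \<and> card (V j) = n" using V by (simp add: vertex_classes_def)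
    have fO: "finite ?O" using Vf by (intro finite_PiE) auto
    have cO: "card ?O = n ^ k" using Vf by (simp add: card_PiE)
    then have neO: "?O \<noteq> {}" using n(2) by (metis card.empty less_irrefl zero_less_power)
    have "real (card {v \<in> ?O. \<not> Q v}) \<le> \<beta> * real (card ?O)"
      using few(1)[OF many] unfolding \<beta>\<epsilon> Q_def cO by simp
    from exists_choice_with_good_mixtures[OF finite_atLeastAtMost fO neO this]
    obtain v where "real (card {w \<in> ?O. \<exists>A\<subseteq>{1..k}. \<not> Q (mix A v w)})
        \<le> 2 ^ card {1..k} * \<beta> * real (card ?O)" by (elim bexE)
    also have "\<dots> = \<theta> * real n ^ k" unfolding cO by (simp add: \<beta>_def)
    finally have v: "real (card {w \<in> ?O. \<exists>A\<subseteq>{1..k}. \<not> Q (mix A v w)}) \<le> \<theta> * real n ^ k" .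
    define good where "good w \<longleftrightarrow> (\<forall>A\<subseteq>{1..k}. Q (mix A v w))" for w
    have bad: "real (card {w \<in> ?O. \<not> good w}) \<le> \<theta> * real n ^ k" using v by (simp add: good_def)
    have "\<exists>lab. (\<forall>j x. lab j x \<in> {1..r}) \<and> (\<forall>w\<in>{w \<in> ?O. good w}. balanced_colouring r k (\<lambda>j. lab j (w j)) \<and>
     (\<forall>i\<in>{1..k}. \<forall>j\<in>{1..k}. {w i, w j} \<in> edges G \<longleftrightarrow> lab i (w i) \<noteq> lab j (w j)))"
    proof (rule exists_labelling[OF assms(1)])
      show "symp (\<lambda>x y. {x, y} \<in> edges G)" by (rule sympI) (simp add: insert_commute)
    qed (use assms(3) in \<open>auto simp: good_def Q_def\<close>)
    then obtain lab where lab: "\<And>j x. lab j x \<in> {1..r}"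
      "\<And>w. w \<in> ?O \<Longrightarrow> good w \<Longrightarrow> balanced_colouring r k (\<lambda>j. lab j (w j)) \<and>
        (\<forall>i\<in>{1..k}. \<forall>j\<in>{1..k}. {w i, w j} \<in> edges G \<longleftrightarrow> lab i (w i) \<noteq> lab j (w j))" by blast
    have "\<exists>T\<in>turan_family r k V. close \<gamma> n G T"
    proof (rule close_to_turan_family_of_labelling[where lab = lab and good = good, OF assms(1) less_imp_le[OF assms(3)] n(2) V G])
      show "lab j x \<in> {1..r}" for j x by (rule lab(1))
      show "balanced_colouring r k (\<lambda>j. lab j (w j)) \<and>
        (\<forall>i\<in>{1..k}. \<forall>j\<in>{1..k}. {w i, w j} \<in> edges G \<longleftrightarrow> lab i (w i) \<noteq> lab j (w j))"
        if "w \<in> ?O" "good w" for w using that by (rule lab(2))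
    qed (rule bad \<eta>0 \<eta>r \<theta>\<eta> \<gamma>2)+
    \<comment> \<open>The upper bound comes from averaging, not from closeness: only transversals
      with a clique can exceed the Turan number, and their total excess is at most \<beta> /
      2.\<close>
    moreover have "real (card (edges G)) \<le> (real (turan_edges r k) + \<gamma>) * (real n)\<^sup>2"
    proof -
      have "2 * real (card (edges G)) \<le> (2 * real (turan_edges r k) + \<beta> / 2) * (real n)\<^sup>2"
        using few(2) unfolding k\<delta> .
      also have "\<dots> \<le> (2 * real (turan_edges r k) + 2 * \<gamma>) * (real n)\<^sup>2"
        using \<beta>\<gamma> \<beta>0 by (intro mult_right_mono) auto
      finally show ?thesis by (simp add: algebra_simps)
    qed
    ultimately show "(\<exists>T\<in>turan_family r k V. close \<gamma> n G T) \<and>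
        real (card (edges G)) \<le> (real (turan_edges r k) + \<gamma>) * (real n)\<^sup>2" by (rule conjI)
  qed
qed

end
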